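(* Let $G$ and $H$ be finite simple graphs. Then the symmetric edge polytopes $\mathcal{P}_G$ and $\mathcal{P}_H$ are unimodularly equivalent if and only if the graphic matroids $\mathcal{M}_G$ and $\mathcal{M}_H$ are isomorphic.
   Context: For a finite simple graph $G$ on vertex set $[m]$, its symmetric edge polytope is $\mathcal{P}_G=\mathrm{conv}\{\pm(\mathbf{e}_i-\mathbf{e}_j) : \{i,j\}\in E(G)\}\subseteq\mathbb{R}^{m}$, where $\mathbf{e}_i$ are standard basis vectors. The graphic matroid $\mathcal{M}_G$ has ground set $E(G)$, with a set of edges independent iff it contains no cycle. Two lattice polytopes (possibly in different ambient spaces $\mathbb{R}^a,\mathbb{R}^b$ and not full-dimensional) are unimodularly equivalent if there is an affine bijection between their affine hulls that maps the lattice points of one affine hull bijectively onto the lattice points of the other and maps one polytope onto the other (for full-dimensional polytopes in $\mathbb{R}^r$: $Q=F(P)+\mathbf{v}$ with $F\in\mathrm{GL}_r(\mathbb{Z})$, $\mathbf{v}\in\mathbb{Z}^r$). *)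

theory Defs
  imports "HOL-Analysis.Analysis"
begin

text \<open>A finite simple graph has a type \<open>'v\<close> of class \<open>finite\<close> as its vertex set and is given by
  its edge set, each edge being a set of two vertices. The ambient space of its symmetric edge
  polytope is \<open>real ^ 'v\<close>.\<close>

definition simple_graph :: "'v::finite set set \<Rightarrow> bool" where
  "simple_graph E \<longleftrightarrow> (\<forall>e\<in>E. card e = 2)"

definition symmetric_edge_polytope :: "'v::finite set set \<Rightarrow> (real ^ 'v) set" where
  "symmetric_edge_polytope E =
     convex hull {x. \<exists>i j. {i, j} \<in> E \<and>
       (x = axis i 1 - axis j 1 \<or> x = - (axis i 1 - axis j 1))}"

definition is_cycle :: "'v set set \<Rightarrow> 'v list \<Rightarrow> bool" where
  "is_cycle X vs \<longleftrightarrow> length vs \<ge> 3 \<and> distinct vs \<and>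
     (\<forall>i < length vs. {vs ! i, vs ! (Suc i mod length vs)} \<in> X)"

record 'a matroid =
  ground :: "'a set"
  indep :: "'a set \<Rightarrow> bool"

definition graphic_matroid :: "'v set set \<Rightarrow> 'v set matroid" where
  "graphic_matroid E =
     \<lparr>ground = E, indep = (\<lambda>X. X \<subseteq> E \<and> \<not> (\<exists>vs. is_cycle X vs))\<rparr>"

definition matroid_isomorphic :: "'a matroid \<Rightarrow> 'b matroid \<Rightarrow> bool" where
  "matroid_isomorphic M N \<longleftrightarrow>
     (\<exists>\<phi>. bij_betw \<phi> (ground M) (ground N) \<and>
       (\<forall>X \<subseteq> ground M. indep M X \<longleftrightarrow> indep N (\<phi> ` X)))"

definition lattice_points :: "(real ^ 'n::finite) set \<Rightarrow> (real ^ 'n) set" where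
  "lattice_points S = {x \<in> S. \<forall>i. x $ i \<in> \<int>}"

definition affine_map_on :: "'a::real_vector set \<Rightarrow> ('a \<Rightarrow> 'b::real_vector) \<Rightarrow> bool" where
  "affine_map_on S f \<longleftrightarrow>
     (\<forall>x\<in>S. \<forall>y\<in>S. \<forall>u v. u + v = 1 \<longrightarrow>
        f (u *\<^sub>R x + v *\<^sub>R y) = u *\<^sub>R f x + v *\<^sub>R f y)"

definition unimodularly_equivalent ::
    "(real ^ 'm::finite) set \<Rightarrow> (real ^ 'n::finite) set \<Rightarrow> bool" where
  "unimodularly_equivalent P Q \<longleftrightarrow>
     (\<exists>f. affine_map_on (affine hull P) f \<and>
          bij_betw f (affine hull P) (affine hull Q) \<and>
          bij_betw f (lattice_points (affine hull P)) (lattice_points (affine hull Q)) \<and>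
          f ` P = Q)"

end

theory Submission
  imports Defs
begin

text \<open>Orient every edge \<open>{i, j}\<close> and send it to the vector \<open>axis i 1 - axis j 1\<close>. Forests are
  exactly the linearly independent sets of edge vectors: deleting an edge of a forest splits off a
  vertex set \<open>S\<close>, and summing coordinates over \<open>S\<close> reads off the coefficient of that edge. The same
  functional shows that edges have coordinates in \<open>{-1, 0, 1}\<close> with respect to a maximal forest, and
  that lattice points of the span have integral ones.

  The vertices of the polytope are the vectors \<open>\<plusminus>u e\<close>, and their sum is \<open>0\<close>. Hence a unimodular
  equivalence fixes \<open>0\<close>, is linear on the span, and permutes edge vectors up to sign, which preserves
  independence. Conversely, a matroid isomorphism gives two coordinate matrices with entries in
  \<open>{-1, 0, 1}\<close> and the same singular minors. Such matrices agree up to signs of rows and columns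
  (unique representability, after Brylawski and Lucas), and the signs turn the isomorphism into a
  linear map of the spans.\<close>

section \<open>Matrices with the same singular minors\<close>

text \<open>Column dependence on the rows \<open>R\<close> stands in for a vanishing determinant, so
  \<open>R\<close> and \<open>C\<close> need neither a common indexing nor equal size.\<close>

definition singular_minor :: "('r \<Rightarrow> 'c \<Rightarrow> real) \<Rightarrow> 'r set \<Rightarrow> 'c set \<Rightarrow> bool" where
  "singular_minor A R C \<longleftrightarrow>
     (\<exists>x. (\<exists>c\<in>C. x c \<noteq> 0) \<and> (\<forall>t\<in>R. (\<Sum>c\<in>C. x c * A t c) = 0))"

lemma singular_minor_singleton: "singular_minor A {t} {c} \<longleftrightarrow> A t c = 0"
  unfolding singular_minor_def by (auto intro: exI[of _ "\<lambda>_. 1"])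

text \<open>Column \<open>i\<close> joins the rows \<open>i\<close> and \<open>Suc i\<close> like an
  edge of a path. Coefficients chosen one after another cancel the inner rows, so that only the ends
  survive: -1 in row 0 and a sign \<sigma> in row \<open>k\<close>.\<close>

lemma path_matrix_combination:
  fixes a :: "nat \<Rightarrow> nat \<Rightarrow> real"
  assumes "\<And>i. i < k \<Longrightarrow> a i i * a i i = 1" "\<And>i. i < k \<Longrightarrow> a (Suc i) i * a (Suc i) i = 1"
    and "\<And>i j. i < k \<Longrightarrow> j \<le> k \<Longrightarrow> j \<noteq> i \<Longrightarrow> j \<noteq> Suc i \<Longrightarrow> a j i = 0"
  shows "\<exists>x \<sigma>. \<sigma> * \<sigma> = 1 \<and> (\<forall>j\<le>k. (\<Sum>i<k. x i * a j i) =
           (if j = k then \<sigma> else 0) - (if j = 0 then 1 else 0))"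
  using assms
proof (induction k)
  case 0
  show ?case by (rule exI, rule exI[of _ 1]) simp
next
  case (Suc k)
  have "\<exists>x \<sigma>. \<sigma> * \<sigma> = 1 \<and> (\<forall>j\<le>k. (\<Sum>i<k. x i * a j i) =
           (if j = k then \<sigma> else 0) - (if j = 0 then 1 else 0))"
    by (rule Suc.IH) (use Suc.prems in auto)
  then obtain x \<sigma> where \<sigma>: "\<sigma> * \<sigma> = 1"
    and x: "\<And>j. j \<le> k \<Longrightarrow> (\<Sum>i<k. x i * a j i) = (if j = k then \<sigma> else 0) - (if j = 0 then 1 else 0)"
    by blast
  \<comment> \<open>The new coefficient cancels the \<sigma> left over in row \<open>k\<close> and
    passes a sign on to row \<open>Suc k\<close>.\<close>
  define y where "y = x(k := - \<sigma> * a k k)"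
  have y: "(\<Sum>i<Suc k. y i * a j i) = (\<Sum>i<k. x i * a j i) - \<sigma> * a k k * a j k" for j
    by (simp add: y_def)
  show ?case
  proof (rule exI[of _ y], rule exI[of _ "- \<sigma> * a k k * a (Suc k) k"], intro conjI allI impI)
    have "(- \<sigma> * a k k * a (Suc k) k) * (- \<sigma> * a k k * a (Suc k) k)
        = (\<sigma> * \<sigma>) * (a k k * a k k) * (a (Suc k) k * a (Suc k) k)"
      by (simp add: algebra_simps)
    then show "(- \<sigma> * a k k * a (Suc k) k) * (- \<sigma> * a k k * a (Suc k) k) = 1"
      using \<sigma> Suc.prems(1,2)[of k] by simp
    fix j assume j: "j \<le> Suc k"
    show "(\<Sum>i<Suc k. y i * a j i) =
        (if j = Suc k then - \<sigma> * a k k * a (Suc k) k else 0) - (if j = 0 then 1 else 0)"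
    proof (cases "j = Suc k")
      case True
      have "(\<Sum>i<k. x i * a j i) = 0"
        by (rule sum.neutral) (use True Suc.prems(3) in auto)
      then show ?thesis using True by (simp add: y del: sum.lessThan_Suc)
    next
      case False
      then have "j \<le> k" using j by simp
      moreover have "\<sigma> * a k k * a k k = \<sigma>" using Suc.prems(1)[of k] by simp
      moreover have "a j k = 0" if "j \<noteq> k" using Suc.prems(3)[of k j] that False j by simp
      ultimately show ?thesis using False by (simp add: y x del: sum.lessThan_Suc)
    qed
  qed
qed

text \<open>On the rows below \<open>k\<close> the matrix is triangular with nonzero diagonal: row
  \<open>i\<close> meets only the columns \<open>i - 1\<close> and \<open>i\<close>. Forward
  substitution kills the coefficients in turn.\<close>

lemma path_matrix_injective:
  fixes a :: "nat \<Rightarrow> nat \<Rightarrow> real"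
  assumes "\<And>i. i < k \<Longrightarrow> a i i * a i i = 1"
    and "\<And>i j. i < k \<Longrightarrow> j \<le> k \<Longrightarrow> j \<noteq> i \<Longrightarrow> j \<noteq> Suc i \<Longrightarrow> a j i = 0"
    and "\<And>j. j < k \<Longrightarrow> (\<Sum>i<k. y i * a j i) = 0"
    and "i < k"
  shows "y i = 0"
  using \<open>i < k\<close>
proof (induction i rule: less_induct)
  case (less i)
  have "(\<Sum>l<k. y l * a i l) = (\<Sum>l\<in>{i}. y l * a i l)"
  proof (rule sum.mono_neutral_right; (use less.prems in auto; fail)?)
    show "\<forall>l\<in>{..<k} - {i}. y l * a i l = 0"
    proof
      fix l assume l: "l \<in> {..<k} - {i}"
      show "y l * a i l = 0"
        using less.IH[of l] assms(2)[of l i] l less.prems by (cases "l < i") auto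
    qed
  qed
  then have "y i * a i i = 0" using assms(3)[OF less.prems] by simp
  then show ?case using assms(1)[OF less.prems] by auto
qed

text \<open>The column \<open>b\<close> meets only the ends of the path and closes it to a cycle.
  Adding \<open>b 0\<close> times the combination \<open>x\<close> of path columns to
  \<open>b\<close> clears row 0 and leaves \<open>b k + \<sigma> * b 0\<close> in row
  \<open>k\<close>. As the path columns are independent, this is the only candidate for a dependence
  up to scaling.\<close>

lemma cycle_matrix_singular_iff:
  fixes a :: "nat \<Rightarrow> nat \<Rightarrow> real" and b :: "nat \<Rightarrow> real"
  assumes "\<And>i. i < k \<Longrightarrow> a i i * a i i = 1"
    and "\<And>i j. i < k \<Longrightarrow> j \<le> k \<Longrightarrow> j \<noteq> i \<Longrightarrow> j \<noteq> Suc i \<Longrightarrow> a j i = 0"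
    and x: "\<And>j. j \<le> k \<Longrightarrow> (\<Sum>i<k. x i * a j i) = (if j = k then \<sigma> else 0) - (if j = 0 then 1 else 0)"
    and "0 < k" and b: "\<And>j. 0 < j \<Longrightarrow> j < k \<Longrightarrow> b j = 0"
  shows "(\<exists>\<beta> y. (\<beta> \<noteq> 0 \<or> (\<exists>i<k. y i \<noteq> 0)) \<and> (\<forall>j\<le>k. \<beta> * b j + (\<Sum>i<k. y i * a j i) = 0))
     \<longleftrightarrow> b k + \<sigma> * b 0 = 0" (is "?L \<longleftrightarrow> ?R")
proof
  have sc: "(\<Sum>i<k. (\<beta> * b 0 * x i) * a j i) = \<beta> * b 0 * (\<Sum>i<k. x i * a j i)" for \<beta> j
    by (simp add: sum_distrib_left mult.assoc)
  {
    assume ?R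
    have "1 * b j + (\<Sum>i<k. (1 * b 0 * x i) * a j i) = 0" if "j \<le> k" for j
      unfolding sc using \<open>?R\<close> b[of j] that \<open>0 < k\<close>
      by (cases "j = 0"; cases "j = k") (auto simp: x algebra_simps)
    then show ?L by (intro exI[of _ 1] exI[of _ "\<lambda>i. 1 * b 0 * x i"]) auto
  next
    assume ?L
    then obtain \<beta> y where nz: "\<beta> \<noteq> 0 \<or> (\<exists>i<k. y i \<noteq> 0)"
      and y: "\<And>j. j \<le> k \<Longrightarrow> \<beta> * b j + (\<Sum>i<k. y i * a j i) = 0" by blast
    \<comment> \<open>The rows below \<open>k\<close> already force \<open>y\<close> to be this
      multiple of \<open>x\<close>.\<close>
    have "y i - \<beta> * b 0 * x i = 0" if "i < k" for i
    proof (rule path_matrix_injective[of k a, OF assms(1,2) _ that])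
      fix j assume j: "j < k"
      have "(\<Sum>i<k. (y i - \<beta> * b 0 * x i) * a j i)
          = (\<Sum>i<k. y i * a j i) - \<beta> * b 0 * (\<Sum>i<k. x i * a j i)"
        unfolding sc[symmetric] by (simp add: left_diff_distrib sum_subtractf)
      then show "(\<Sum>i<k. (y i - \<beta> * b 0 * x i) * a j i) = 0"
        using y[of j] b[of j] j by (cases "j = 0") (auto simp: x)
    qed
    then have yx: "y i = \<beta> * b 0 * x i" if "i < k" for i using that by fastforce
    then have "\<beta> \<noteq> 0" using nz by auto
    have "(\<Sum>i<k. y i * a k i) = (\<Sum>i<k. (\<beta> * b 0 * x i) * a k i)"
      by (rule sum.cong) (simp_all add: yx)
    then have "\<beta> * (b k + \<sigma> * b 0) = 0"
      using y[of k] \<open>0 < k\<close> unfolding sc by (simp add: x algebra_simps)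
    then show ?R using \<open>\<beta> \<noteq> 0\<close> by simp
  }
qed

text \<open>The form that \<open>cycle_matrix_singular_iff\<close> decides. Only \<open>c\<close>
  has to be injective, as a repeated row merely repeats an equation.\<close>

lemma singular_minor_indexed:
  fixes t :: "nat \<Rightarrow> 'r" and c :: "nat \<Rightarrow> 'c"
  assumes "inj_on c {..<k}" "n \<notin> c ` {..<k}"
  shows "singular_minor A (t ` {..k}) (insert n (c ` {..<k})) \<longleftrightarrow>
    (\<exists>\<beta> y. (\<beta> \<noteq> 0 \<or> (\<exists>i<k. y i \<noteq> 0)) \<and>
       (\<forall>j\<le>k. \<beta> * A (t j) n + (\<Sum>i<k. y i * A (t j) (c i)) = 0))" (is "_ \<longleftrightarrow> ?R")
proof
  have sm: "(\<Sum>d\<in>insert n (c ` {..<k}). x d * A s d) = x n * A s n + (\<Sum>i<k. x (c i) * A s (c i))"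
    for x s using assms by (simp add: sum.reindex)
  {
    assume "singular_minor A (t ` {..k}) (insert n (c ` {..<k}))"
    then obtain x where x: "\<exists>d\<in>insert n (c ` {..<k}). x d \<noteq> 0"
      "\<forall>s\<in>t ` {..k}. x n * A s n + (\<Sum>i<k. x (c i) * A s (c i)) = 0"
      unfolding singular_minor_def sm by blast
    show ?R by (rule exI[of _ "x n"], rule exI[of _ "x \<circ> c"]) (use x in auto)
  next
    assume ?R
    then obtain \<beta> y where y: "\<beta> \<noteq> 0 \<or> (\<exists>i<k. y i \<noteq> 0)"
      "\<forall>j\<le>k. \<beta> * A (t j) n + (\<Sum>i<k. y i * A (t j) (c i)) = 0" by blast
    define x where "x = (\<lambda>d. if d = n then \<beta> else y (the_inv_into {..<k} c d))"
    have xn: "x n = \<beta>" by (simp add: x_def)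
    have xc: "x (c i) = y i" if "i < k" for i
      using that assms by (auto simp: x_def the_inv_into_f_f)
    show "singular_minor A (t ` {..k}) (insert n (c ` {..<k}))"
      unfolding singular_minor_def sm
      by (rule exI[of _ x]) (use y in \<open>auto simp: xn xc\<close>)
  }
qed

text \<open>A shortest walk violating the claim spans an induced cycle of the bipartite support graph.
  The minors of \<open>A\<close> and \<open>B\<close> on it differ in the sign of one entry, so exactly one of them is
  singular.\<close>

lemma equal_sign_ratio_if_connected:
  fixes A B :: "'r \<Rightarrow> 'c \<Rightarrow> real"
  assumes ent: "\<And>t c. t \<in> T \<Longrightarrow> c \<in> insert n F \<Longrightarrow> A t c \<in> {-1, 0, 1} \<and> B t c \<in> {-1, 0, 1}"
    and eq: "\<And>t c. t \<in> T \<Longrightarrow> c \<in> F \<Longrightarrow> A t c = B t c"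
    and "n \<notin> F"
    and sing: "\<And>R C. R \<subseteq> T \<Longrightarrow> C \<subseteq> insert n F \<Longrightarrow> singular_minor A R C \<longleftrightarrow> singular_minor B R C"
    and "(\<lambda>t t'. t \<in> T \<and> t' \<in> T \<and> (\<exists>c\<in>F. A t c \<noteq> 0 \<and> A t' c \<noteq> 0))\<^sup>*\<^sup>* t t'"
    and "t \<in> T" "A t n \<noteq> 0" "A t' n \<noteq> 0"
  shows "A t n * B t n = A t' n * B t' n"
proof (rule ccontr)
  let ?adj = "\<lambda>t t'. t \<in> T \<and> t' \<in> T \<and> (\<exists>c\<in>F. A t c \<noteq> 0 \<and> A t' c \<noteq> 0)"
  let ?rt = "\<lambda>t. A t n * B t n"
  \<comment> \<open>A counterexample is a walk of rows, stored as a length and a function on the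
    naturals so that shortening is reindexing. The shortest one yields an induced cycle through
    column \<open>n\<close>.\<close>
  define bad where "bad = (\<lambda>k p. (\<forall>i<k. ?adj (p i) (p (Suc i))) \<and> p 0 \<in> T \<and>
    A (p 0) n \<noteq> 0 \<and> A (p k) n \<noteq> 0 \<and> ?rt (p 0) \<noteq> ?rt (p k))"
  assume neq: "?rt t \<noteq> ?rt t'"
  from \<open>?adj\<^sup>*\<^sup>* t t'\<close> obtain m where "(?adj ^^ m) t t'" by (meson rtranclp_imp_relpowp)
  then obtain q where "q 0 = t" "q m = t'" "\<forall>i<m. ?adj (q i) (q (Suc i))"
    unfolding relpowp_fun_conv by blast
  then have "\<exists>p. bad m p" using assms(6,7,8) neq unfolding bad_def by (intro exI[of _ q]) simp
  then have ex: "\<exists>k p. bad k p" by blast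
  define k where "k = (LEAST k. \<exists>p. bad k p)"
  obtain p where bad: "bad k p" using LeastI_ex[OF ex] unfolding k_def by blast
  have min: "k \<le> k'" if "bad k' p'" for k' p'
    unfolding k_def using that by (intro Least_le) blast
  from bad have adj: "\<And>i. i < k \<Longrightarrow> ?adj (p i) (p (Suc i))" and p0: "p 0 \<in> T"
    and A0: "A (p 0) n \<noteq> 0" and Ak: "A (p k) n \<noteq> 0" and rt: "?rt (p 0) \<noteq> ?rt (p k)"
    unfolding bad_def by auto
  have "0 < k" using rt by (cases k) auto
  have pT: "p i \<in> T" if "i \<le> k" for i
    using adj[of "i - 1"] p0 that by (cases i) auto
  \<comment> \<open>An inner row meeting column \<open>n\<close> has a ratio different from that of
    one of the ends, so the tail or the head of the walk would be a shorter counterexample.\<close>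
  have inner: "A (p i) n = 0" if "0 < i" "i < k" for i
  proof (rule ccontr)
    assume nz: "A (p i) n \<noteq> 0"
    show False
    proof (cases "?rt (p i) = ?rt (p 0)")
      case True
      have "bad (k - i) (\<lambda>j. p (j + i))"
        unfolding bad_def using that adj pT[of i] nz Ak rt True by auto
      then show False using min that by fastforce
    next
      case False
      have "bad i p" unfolding bad_def using that adj p0 A0 nz False by auto
      then show False using min that by fastforce
    qed
  qed
  have chord: False if "i < j" "j \<le> k" "j \<noteq> Suc i" "d \<in> F" "A (p i) d \<noteq> 0" "A (p j) d \<noteq> 0" for i j d
  proof -
    \<comment> \<open>Two rows sharing a column allow a jump from \<open>p i\<close> straight to
      \<open>p j\<close>, which drops the \<open>j - Suc i\<close> rows in between.\<close>
    define q where "q = (\<lambda>m. if m \<le> i then p m else p (m + (j - Suc i)))"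
    define l where "l = k - (j - Suc i)"
    have "l < k" "i < l" using that by (auto simp: l_def)
    have "?adj (q m) (q (Suc m))" if "m < l" for m
    proof -
      consider "m < i" | "m = i" | "m > i" by linarith
      then show ?thesis
      proof cases
        case 1 then show ?thesis using adj[of m] \<open>i < j\<close> \<open>j \<le> k\<close> by (simp add: q_def)
      next
        case 2
        then have "q m = p i" "q (Suc m) = p j" using \<open>i < j\<close> by (auto simp: q_def)
        moreover have "p i \<in> T" "p j \<in> T" using pT \<open>i < j\<close> \<open>j \<le> k\<close> by auto
        ultimately show ?thesis using \<open>d \<in> F\<close> \<open>A (p i) d \<noteq> 0\<close> \<open>A (p j) d \<noteq> 0\<close> by auto
      next
        case 3 then show ?thesis using adj[of "m + (j - Suc i)"] that by (auto simp: q_def l_def)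
      qed
    qed
    moreover have "q 0 = p 0" "q l = p k" using \<open>i < l\<close> \<open>i < j\<close> \<open>j \<le> k\<close> by (auto simp: q_def l_def)
    ultimately have "bad l q" unfolding bad_def using p0 A0 Ak rt by auto
    then show False using min \<open>l < k\<close> by fastforce
  qed
  have "\<forall>i\<in>{..<k}. \<exists>d. d \<in> F \<and> A (p i) d \<noteq> 0 \<and> A (p (Suc i)) d \<noteq> 0" using adj by blast
  then obtain c where c: "\<And>i. i < k \<Longrightarrow> c i \<in> F \<and> A (p i) (c i) \<noteq> 0 \<and> A (p (Suc i)) (c i) \<noteq> 0"
    by (metis lessThan_iff)
  \<comment> \<open>Chords being excluded, the column \<open>c i\<close> meets the walk only in its
    own two rows.\<close>
  have off: "A (p j) (c i) = 0" if "i < k" "j \<le> k" "j \<noteq> i" "j \<noteq> Suc i" for i j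
    using chord[of i j "c i"] chord[of j "Suc i" "c i"] c[OF \<open>i < k\<close>] that
    by (cases "i < j") auto
  have "inj_on c {..<k}"
  proof (rule linorder_inj_onI)
    show "c i \<noteq> c j" if "i < j" "i \<in> {..<k}" "j \<in> {..<k}" for i j
      using off[of i "Suc j"] c[of j] that by force
  qed auto
  have "n \<notin> c ` {..<k}" using c \<open>n \<notin> F\<close> by auto
  have sub: "p ` {..k} \<subseteq> T" "insert n (c ` {..<k}) \<subseteq> insert n F" using pT c by auto
  have sq: "A s d * A s d = 1" if "s \<in> T" "d \<in> insert n F" "A s d \<noteq> 0" for s d
    using ent[OF that(1,2)] that(3) by auto
  have d1: "A (p i) (c i) * A (p i) (c i) = 1" "A (p (Suc i)) (c i) * A (p (Suc i)) (c i) = 1"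
    if "i < k" for i using sq c pT that by auto
  obtain x \<sigma> where \<sigma>: "\<sigma> * \<sigma> = 1" and x: "\<And>j. j \<le> k \<Longrightarrow> (\<Sum>i<k. x i * A (p j) (c i)) =
           (if j = k then \<sigma> else 0) - (if j = 0 then 1 else 0)"
    using path_matrix_combination[of k "\<lambda>j i. A (p j) (c i)"] d1 off by blast
  have supp: "A s n = 0 \<longleftrightarrow> B s n = 0" if "s \<in> T" for s
    using sing[of "{s}" "{n}"] that by (simp add: singular_minor_singleton)
  have "singular_minor A (p ` {..k}) (insert n (c ` {..<k})) \<longleftrightarrow> A (p k) n + \<sigma> * A (p 0) n = 0"
    unfolding singular_minor_indexed[OF \<open>inj_on c {..<k}\<close> \<open>n \<notin> c ` {..<k}\<close>]
    by (rule cycle_matrix_singular_iff[of k "\<lambda>j i. A (p j) (c i)" x \<sigma> "\<lambda>j. A (p j) n"])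
      (use d1 off x inner \<open>0 < k\<close> in auto)
  moreover have "singular_minor B (p ` {..k}) (insert n (c ` {..<k})) \<longleftrightarrow> B (p k) n + \<sigma> * B (p 0) n = 0"
  proof -
    have AB: "B (p j) (c i) = A (p j) (c i)" if "j \<le> k" "i < k" for i j
      using eq pT c that by auto
    show ?thesis
      unfolding singular_minor_indexed[OF \<open>inj_on c {..<k}\<close> \<open>n \<notin> c ` {..<k}\<close>]
      by (rule cycle_matrix_singular_iff[of k "\<lambda>j i. B (p j) (c i)" x \<sigma> "\<lambda>j. B (p j) n"])
        (use d1 off x inner \<open>0 < k\<close> pT in \<open>auto simp: AB supp[symmetric]\<close>)
  qed
  \<comment> \<open>For either matrix, singularity says that the product of its two end entries in
    column \<open>n\<close> is \<open>- \<sigma>\<close>. These products are signs, so they agree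
    for \<open>A\<close> and \<open>B\<close>, and hence so do the ratios at the two ends.\<close>
  ultimately have key: "A (p k) n + \<sigma> * A (p 0) n = 0 \<longleftrightarrow> B (p k) n + \<sigma> * B (p 0) n = 0"
    using sing[OF sub] by simp
  have "\<sigma> = 1 \<or> \<sigma> = -1" using \<sigma> square_eq_1_iff by blast
  then show False
    using key rt A0 Ak supp[of "p 0"] supp[of "p k"] ent[of "p 0" n] ent[of "p k" n] p0 pT[of k]
    by auto
qed

section \<open>Sign normalisation, one column at a time\<close>

lemma singular_minor_rescale:
  fixes A :: "'r \<Rightarrow> 'c \<Rightarrow> real"
  assumes "\<And>t. t \<in> R \<Longrightarrow> r t * r t = 1" "\<And>c. c \<in> C \<Longrightarrow> s c * s c = 1"
  shows "singular_minor (\<lambda>t c. r t * s c * A t c) R C \<longleftrightarrow> singular_minor A R C"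
proof -
  have *: "(\<Sum>c\<in>C. x c * (r t * s c * A t c)) = r t * (\<Sum>c\<in>C. (s c * x c) * A t c)" for x t
    by (simp add: sum_distrib_left mult_ac)
  have r0: "r t \<noteq> 0" if "t \<in> R" for t using assms(1)[OF that] by auto
  have s0: "s c \<noteq> 0" if "c \<in> C" for c using assms(2)[OF that] by auto
  show ?thesis
  proof
    assume "singular_minor (\<lambda>t c. r t * s c * A t c) R C"
    then obtain x where "\<exists>c\<in>C. x c \<noteq> 0" "\<forall>t\<in>R. (\<Sum>c\<in>C. (s c * x c) * A t c) = 0"
      unfolding singular_minor_def * using r0 by auto
    then show "singular_minor A R C" unfolding singular_minor_def
      using s0 by (intro exI[of _ "\<lambda>c. s c * x c"]) auto
  next
    assume "singular_minor A R C"
    then obtain x where x: "\<exists>c\<in>C. x c \<noteq> 0" "\<forall>t\<in>R. (\<Sum>c\<in>C. x c * A t c) = 0"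
      unfolding singular_minor_def by auto
    have "(\<Sum>c\<in>C. (s c * (s c * x c)) * A t c) = (\<Sum>c\<in>C. x c * A t c)" for t
      by (rule sum.cong) (use assms(2) in \<open>auto simp flip: mult.assoc\<close>)
    then show "singular_minor (\<lambda>t c. r t * s c * A t c) R C"
      unfolding singular_minor_def * using x s0 by (intro exI[of _ "\<lambda>c. s c * x c"]) auto
  qed
qed

text \<open>Induction on the columns. Once the earlier columns agree, the ratio of the two entries
  in the new column \<open>n\<close> is constant on each component of the row graph. Multiplying the
  rows of a component and the earlier columns that it meets by this ratio repairs column
  \<open>n\<close> and leaves the earlier columns unchanged.\<close>

lemma sign_equivalent_if_same_singular_minors:
  fixes A B :: "'r \<Rightarrow> 'c \<Rightarrow> real"
  assumes "finite F"
    and "\<And>t c. t \<in> T \<Longrightarrow> c \<in> F \<Longrightarrow> A t c \<in> {-1, 0, 1} \<and> B t c \<in> {-1, 0, 1}"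
    and "\<And>R C. R \<subseteq> T \<Longrightarrow> C \<subseteq> F \<Longrightarrow> singular_minor A R C \<longleftrightarrow> singular_minor B R C"
  shows "\<exists>r s. (\<forall>t. r t \<in> {-1, 1}) \<and> (\<forall>c. s c \<in> {-1, 1}) \<and>
    (\<forall>t\<in>T. \<forall>c\<in>F. B t c = r t * s c * A t c)"
  using assms
proof (induction F)
  case empty
  show ?case by (rule exI[of _ "\<lambda>_. 1"], rule exI[of _ "\<lambda>_. 1"]) simp
next
  case (insert n F)
  have "\<exists>r s. (\<forall>t. r t \<in> {-1, 1}) \<and> (\<forall>c. s c \<in> {-1, 1}) \<and>
    (\<forall>t\<in>T. \<forall>c\<in>F. B t c = r t * s c * A t c)"
  proof (rule insert.IH)
    show "A t c \<in> {-1, 0, 1} \<and> B t c \<in> {-1, 0, 1}" if "t \<in> T" "c \<in> F" for t c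
      using insert.prems(1) that by blast
    show "singular_minor A R C \<longleftrightarrow> singular_minor B R C" if "R \<subseteq> T" "C \<subseteq> F" for R C
      using insert.prems(2) that by blast
  qed
  then obtain r s where r: "\<And>t. r t \<in> {-1, 1}" and s: "\<And>c. s c \<in> {-1, 1}"
    and rs: "\<And>t c. t \<in> T \<Longrightarrow> c \<in> F \<Longrightarrow> B t c = r t * s c * A t c" by metis
  \<comment> \<open>\<open>A'\<close> absorbs the signs found so far and coincides with
    \<open>B\<close> on \<open>F\<close>.\<close>
  define A' where "A' = (\<lambda>t c. r t * s c * A t c)"
  have rr: "r t * r t = 1" and ss: "s c * s c = 1" for t c using r[of t] s[of c] by auto
  have ent: "A' t c \<in> {-1, 0, 1} \<and> B t c \<in> {-1, 0, 1}" if "t \<in> T" "c \<in> insert n F" for t c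
    using insert.prems(1)[OF that] r[of t] s[of c] by (auto simp: A'_def)
  have eq: "A' t c = B t c" if "t \<in> T" "c \<in> F" for t c using rs that by (simp add: A'_def)
  have sing: "singular_minor A' R C \<longleftrightarrow> singular_minor B R C" if "R \<subseteq> T" "C \<subseteq> insert n F" for R C
    unfolding A'_def using insert.prems(2)[OF that] singular_minor_rescale[of R r C s A] rr ss by simp
  have supp: "A' t n = 0 \<longleftrightarrow> B t n = 0" if "t \<in> T" for t
    using sing[of "{t}" "{n}"] that by (simp add: singular_minor_singleton)
  define adj where "adj = (\<lambda>t t'. t \<in> T \<and> t' \<in> T \<and> (\<exists>c\<in>F. A' t c \<noteq> 0 \<and> A' t' c \<noteq> 0))"
  have adj_sym: "adj\<^sup>*\<^sup>* t t' \<Longrightarrow> adj\<^sup>*\<^sup>* t' t" for t t'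
    by (rule sympD[OF symp_rtranclp]) (auto simp: adj_def symp_def)
  have conn: "A' t n * B t n = A' t' n * B t' n"
    if "adj\<^sup>*\<^sup>* t t'" "t \<in> T" "A' t n \<noteq> 0" "A' t' n \<noteq> 0" for t t'
    by (rule equal_sign_ratio_if_connected[of T n F A' B t t'])
      (use ent eq \<open>n \<notin> F\<close> sing that in \<open>auto simp: adj_def\<close>)
  define P where "P = (\<lambda>t t'. t' \<in> T \<and> adj\<^sup>*\<^sup>* t t' \<and> A' t' n \<noteq> 0)"
  \<comment> \<open>The ratio at some row of the component of \<open>t\<close> that meets column
    \<open>n\<close>; a component missing this column keeps the sign 1.\<close>
  define \<rho> where "\<rho> = (\<lambda>t. if Ex (P t) then A' (Eps (P t)) n * B (Eps (P t)) n else 1)"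
  have \<rho>_pm: "\<rho> t \<in> {-1, 1}" for t
  proof (cases "Ex (P t)")
    case True
    then have "P t (Eps (P t))" by (rule someI_ex)
    then have *: "Eps (P t) \<in> T" "A' (Eps (P t)) n \<noteq> 0" by (auto simp: P_def)
    then show ?thesis using ent[OF *(1), of n] supp[OF *(1)] True by (auto simp: \<rho>_def)
  next
    case False
    then show ?thesis unfolding \<rho>_def by (subst if_not_P) auto
  qed
  have \<rho>_adj: "\<rho> t = \<rho> t'" if "adj t t'" for t t'
  proof -
    have "adj\<^sup>*\<^sup>* t q \<longleftrightarrow> adj\<^sup>*\<^sup>* t' q" for q
      using that adj_sym[of t t'] by (meson r_into_rtranclp rtranclp_trans)
    \<comment> \<open>Equal predicates make the same choice \<open>Eps\<close>, so \<rho> is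
      constant on components by construction.\<close>
    then have "P t = P t'" by (auto simp: P_def)
    then show ?thesis by (simp only: \<rho>_def)
  qed
  have \<rho>_n: "\<rho> t = A' t n * B t n" if "t \<in> T" "A' t n \<noteq> 0" for t
  proof -
    have "P t t" using that by (simp add: P_def)
    then have "P t (Eps (P t))" by (rule someI)
    then show ?thesis using conn[of t "Eps (P t)"] that \<open>P t t\<close> by (auto simp: \<rho>_def P_def)
  qed
  define Q where "Q = (\<lambda>c t. t \<in> T \<and> A' t c \<noteq> 0)"
  \<comment> \<open>An earlier column that is nonzero on \<open>T\<close> lies in a single component
    and takes its sign, so that \<open>\<rho> t * \<tau> c = 1\<close> on its support. Column
    \<open>n\<close> has sign 1 and is corrected by the row signs alone.\<close>
  define \<tau> where "\<tau> = (\<lambda>c. if c \<in> F \<and> Ex (Q c) then \<rho> (Eps (Q c)) else 1)"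
  have \<tau>_pm: "\<tau> c \<in> {-1, 1}" for c using \<rho>_pm by (auto simp: \<tau>_def)
  have \<tau>_F: "\<tau> c = \<rho> t" if "c \<in> F" "t \<in> T" "A' t c \<noteq> 0" for c t
  proof -
    have "Q c t" using that by (simp add: Q_def)
    then have "Q c (Eps (Q c))" by (rule someI)
    then have "adj (Eps (Q c)) t" using that by (auto simp: Q_def adj_def)
    then show ?thesis using \<rho>_adj \<open>Q c t\<close> that by (auto simp: \<tau>_def)
  qed
  have "B t c = \<rho> t * \<tau> c * A' t c" if "t \<in> T" "c \<in> insert n F" for t c
  proof (cases "c = n")
    case True
    then have "\<tau> c = 1" using \<open>n \<notin> F\<close> by (simp add: \<tau>_def)
    then show ?thesis
      using True \<rho>_n[of t] supp[of t] ent[of t n] that by (cases "A' t n = 0") auto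
  next
    case False
    then show ?thesis
      using eq[of t c] \<tau>_F[of c t] \<rho>_pm[of t] that by (cases "A' t c = 0") auto
  qed
  then have "\<forall>t\<in>T. \<forall>c\<in>insert n F. B t c = (\<rho> t * r t) * (\<tau> c * s c) * A t c"
    by (simp add: A'_def mult_ac)
  moreover have "\<rho> t * r t \<in> {-1, 1}" "\<tau> c * s c \<in> {-1, 1}" for t c
    using \<rho>_pm[of t] \<tau>_pm[of c] r[of t] s[of c] by auto
  ultimately show ?case
    by (intro exI[of _ "\<lambda>t. \<rho> t * r t"] exI[of _ "\<lambda>c. \<tau> c * s c"]) blast
qed

section \<open>Independent families of vectors\<close>

text \<open>A family indexed by edges rather than a set of vectors: equal vectors at different
  indices count as dependent, and index sets can be moved along a bijection of edges.\<close>

definition independent_family :: "('e \<Rightarrow> 'a::real_vector) \<Rightarrow> 'e set \<Rightarrow> bool" where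
  "independent_family u X \<longleftrightarrow>
     (\<forall>z. (\<Sum>e\<in>X. z e *\<^sub>R u e) = 0 \<longrightarrow> (\<forall>e\<in>X. z e = 0))"

lemma independent_familyD:
  assumes "independent_family u X" "(\<Sum>e\<in>X. z e *\<^sub>R u e) = 0" "e \<in> X"
  shows "z e = 0"
  using assms unfolding independent_family_def by blast

lemma independent_family_coeff_unique:
  assumes "independent_family u X" "(\<Sum>e\<in>X. y e *\<^sub>R u e) = (\<Sum>e\<in>X. z e *\<^sub>R u e)" "e \<in> X"
  shows "y e = z e"
proof -
  have "(\<Sum>e\<in>X. (y e - z e) *\<^sub>R u e) = 0"
    using assms(2) by (simp add: scaleR_left_diff_distrib sum_subtractf)
  then show ?thesis using independent_familyD[OF assms(1) _ assms(3)] by fastforce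
qed

lemma sum_scaleR_zero_outside:
  fixes u :: "'e \<Rightarrow> 'a::real_vector"
  assumes "finite X" "Y \<subseteq> X"
  shows "(\<Sum>e\<in>X. (if e \<in> Y then z e else 0) *\<^sub>R u e) = (\<Sum>e\<in>Y. z e *\<^sub>R u e)"
proof -
  have "(\<Sum>e\<in>X. (if e \<in> Y then z e else 0) *\<^sub>R u e) = (\<Sum>e\<in>Y. (if e \<in> Y then z e else 0) *\<^sub>R u e)"
    by (rule sum.mono_neutral_right) (use assms in auto)
  also have "\<dots> = (\<Sum>e\<in>Y. z e *\<^sub>R u e)" by (rule sum.cong) auto
  finally show ?thesis .
qed

lemma independent_family_subset:
  assumes "independent_family u X" "finite X" "Y \<subseteq> X"
  shows "independent_family u Y"
  unfolding independent_family_def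
proof (intro allI impI ballI)
  fix z e assume z: "(\<Sum>e\<in>Y. z e *\<^sub>R u e) = 0" and e: "e \<in> Y"
  have "(\<Sum>e\<in>X. (if e \<in> Y then z e else 0) *\<^sub>R u e) = 0"
    unfolding sum_scaleR_zero_outside[OF assms(2,3)] by (rule z)
  then have "(if e \<in> Y then z e else 0) = 0"
    by (rule independent_familyD[OF assms(1)]) (use e assms(3) in auto)
  then show "z e = 0" using e by simp
qed

lemma in_span_if_dependent_insert:
  assumes "independent_family u T" "finite T" "\<not> independent_family u (insert e T)"
  shows "\<exists>a. u e = (\<Sum>t\<in>T. a t *\<^sub>R u t)"
proof -
  have "e \<notin> T" using assms by (metis insert_absorb)
  obtain z d where z: "(\<Sum>t\<in>insert e T. z t *\<^sub>R u t) = 0" "d \<in> insert e T" "z d \<noteq> 0"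
    using assms(3) unfolding independent_family_def by blast
  then have s: "z e *\<^sub>R u e + (\<Sum>t\<in>T. z t *\<^sub>R u t) = 0" using \<open>e \<notin> T\<close> assms(2) by simp
  have "z e \<noteq> 0"
  proof
    assume "z e = 0"
    then have "(\<Sum>t\<in>T. z t *\<^sub>R u t) = 0" "d \<in> T" using s z by auto
    then show False using independent_familyD[OF assms(1)] z(3) by blast
  qed
  have s': "z e *\<^sub>R u e = - (\<Sum>t\<in>T. z t *\<^sub>R u t)" using s by (simp add: eq_neg_iff_add_eq_0)
  have "u e = inverse (z e) *\<^sub>R (z e *\<^sub>R u e)" using \<open>z e \<noteq> 0\<close> by simp
  also have "\<dots> = inverse (z e) *\<^sub>R (- (\<Sum>t\<in>T. z t *\<^sub>R u t))" by (simp only: s')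
  also have "\<dots> = (\<Sum>t\<in>T. (- inverse (z e) * z t) *\<^sub>R u t)" by (simp add: scaleR_sum_right sum_negf)
  finally show ?thesis by (intro exI)
qed

lemma independent_family_inj_on:
  assumes "independent_family u X" "finite X"
  shows "inj_on u X"
proof (rule inj_onI, rule ccontr)
  fix a b assume ab: "a \<in> X" "b \<in> X" "u a = u b" "a \<noteq> b"
  have "independent_family u {a, b}" by (rule independent_family_subset[OF assms]) (use ab in auto)
  moreover have "(\<Sum>x\<in>{a, b}. (if x = a then 1 else -1) *\<^sub>R u x) = 0" using ab(3,4) by simp
  ultimately have "(if a = a then 1 else -1 :: real) = 0" by (rule independent_familyD) simp
  then show False by simp
qed

lemma independent_family_imp_independent:
  assumes "independent_family u X" "finite X"
  shows "independent (u ` X)"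
proof
  assume "dependent (u ` X)"
  then obtain f v where f: "v \<in> u ` X" "f v \<noteq> 0" "(\<Sum>v\<in>u ` X. f v *\<^sub>R v) = 0"
    using assms(2) by (auto simp: dependent_finite)
  then obtain e where e: "e \<in> X" "v = u e" by auto
  have "(\<Sum>e\<in>X. f (u e) *\<^sub>R u e) = 0"
    using f(3) independent_family_inj_on[OF assms] by (simp add: sum.reindex)
  then show False using independent_familyD[OF assms(1), of "f \<circ> u" e] e f by simp
qed

lemma sum_coeff_swap:
  fixes u :: "'e \<Rightarrow> 'a::real_vector"
  assumes "\<And>c. c \<in> C \<Longrightarrow> u c = (\<Sum>t\<in>T. A t c *\<^sub>R u t)"
  shows "(\<Sum>c\<in>C. x c *\<^sub>R u c) = (\<Sum>t\<in>T. (\<Sum>c\<in>C. x c * A t c) *\<^sub>R u t)"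
proof -
  have "(\<Sum>c\<in>C. x c *\<^sub>R u c) = (\<Sum>c\<in>C. \<Sum>t\<in>T. (x c * A t c) *\<^sub>R u t)"
    by (rule sum.cong) (simp_all add: assms scaleR_sum_right[symmetric] flip: scaleR_scaleR)
  also have "\<dots> = (\<Sum>t\<in>T. (\<Sum>c\<in>C. x c * A t c) *\<^sub>R u t)"
    unfolding scaleR_sum_left by (rule sum.swap)
  finally show ?thesis .
qed

text \<open>Modulo the span of \<open>T - R\<close>, the coordinates of \<open>u c\<close> are the
  column \<open>c\<close> cut down to the rows \<open>R\<close>. Singular minors thus become
  dependent exchanges \<open>C \<union> (T - R)\<close> in the basis \<open>T\<close>, which the
  matroid can see.\<close>

lemma singular_minor_iff_dependent:
  fixes u :: "'e \<Rightarrow> 'a::real_vector"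
  assumes ind: "independent_family u T" and fin: "finite T" "finite C" and "R \<subseteq> T" "C \<inter> T = {}"
    and A: "\<And>c. c \<in> C \<Longrightarrow> u c = (\<Sum>t\<in>T. A t c *\<^sub>R u t)"
  shows "singular_minor A R C \<longleftrightarrow> \<not> independent_family u (C \<union> (T - R))"
proof
  have split: "(\<Sum>e\<in>C \<union> (T - R). z e *\<^sub>R u e) = (\<Sum>e\<in>C. z e *\<^sub>R u e) + (\<Sum>e\<in>T - R. z e *\<^sub>R u e)" for z
    by (rule sum.union_disjoint) (use assms in auto)
  {
    assume "singular_minor A R C"
    then obtain x where x: "\<exists>c\<in>C. x c \<noteq> 0" "\<And>t. t \<in> R \<Longrightarrow> (\<Sum>c\<in>C. x c * A t c) = 0"
      unfolding singular_minor_def by blast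
    \<comment> \<open>The rows in \<open>R\<close> cancel already; the coefficients on
      \<open>T - R\<close> cancel what remains in the other rows.\<close>
    define z where "z = (\<lambda>e. if e \<in> C then x e else - (\<Sum>c\<in>C. x c * A e c))"
    have "(\<Sum>e\<in>C. z e *\<^sub>R u e) = (\<Sum>e\<in>C. x e *\<^sub>R u e)" by (rule sum.cong) (auto simp: z_def)
    also have "\<dots> = (\<Sum>t\<in>T. (\<Sum>c\<in>C. x c * A t c) *\<^sub>R u t)" using A by (rule sum_coeff_swap)
    also have "\<dots> = (\<Sum>t\<in>T - R. (\<Sum>c\<in>C. x c * A t c) *\<^sub>R u t)"
      by (rule sum.mono_neutral_right) (use fin x(2) in auto)
    also have "\<dots> = (\<Sum>t\<in>T - R. - (z t *\<^sub>R u t))"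
      by (rule sum.cong) (use assms(5) in \<open>auto simp: z_def\<close>)
    finally have "(\<Sum>e\<in>C \<union> (T - R). z e *\<^sub>R u e) = 0" by (simp add: split sum_negf)
    moreover have "\<exists>c\<in>C. z c \<noteq> 0" using x(1) by (auto simp: z_def)
    ultimately show "\<not> independent_family u (C \<union> (T - R))"
      unfolding independent_family_def by blast
  next
    assume "\<not> independent_family u (C \<union> (T - R))"
    then obtain z d where z: "(\<Sum>e\<in>C \<union> (T - R). z e *\<^sub>R u e) = 0" "d \<in> C \<union> (T - R)" "z d \<noteq> 0"
      unfolding independent_family_def by blast
    have "(\<Sum>t\<in>T. ((\<Sum>c\<in>C. z c * A t c) + (if t \<in> T - R then z t else 0)) *\<^sub>R u t)
       = (\<Sum>e\<in>C. z e *\<^sub>R u e) + (\<Sum>t\<in>T - R. z t *\<^sub>R u t)"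
      unfolding scaleR_left_distrib sum.distrib
      by (subst sum_scaleR_zero_outside) (use fin sum_coeff_swap[OF A, where x = z] in auto)
    also have "\<dots> = 0" using z(1) split by simp
    finally have eq: "(\<Sum>c\<in>C. z c * A t c) + (if t \<in> T - R then z t else 0) = 0" if "t \<in> T" for t
      using independent_familyD[OF ind, of "\<lambda>t. (\<Sum>c\<in>C. z c * A t c) + (if t \<in> T - R then z t else 0)" t]
        that by simp
    have "\<forall>t\<in>R. (\<Sum>c\<in>C. z c * A t c) = 0" using eq \<open>R \<subseteq> T\<close> by fastforce
    \<comment> \<open>Were all coefficients on \<open>C\<close> zero, independence of
      \<open>T\<close> would make the others vanish too.\<close>
    moreover have "\<exists>c\<in>C. z c \<noteq> 0"
    proof (rule ccontr)
      assume "\<not> (\<exists>c\<in>C. z c \<noteq> 0)"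
      then have "(\<Sum>c\<in>C. z c * A d c) = 0" "d \<in> T - R" using z by auto
      then show False using eq[of d] z(3) by simp
    qed
    ultimately show "singular_minor A R C" unfolding singular_minor_def by blast
  }
qed

text \<open>The conclusion prepares a linear map: sending \<open>u t\<close> to
  \<open>r t *\<^sub>R w t\<close> on the basis sends every \<open>u e\<close> to a signed
  \<open>w e\<close>. The matrices are compared only outside \<open>T\<close>, where the exchange
  criterion applies.\<close>

lemma sign_equivalent_coordinates:
  fixes u :: "'e \<Rightarrow> 'a::real_vector" and w :: "'e \<Rightarrow> 'b::real_vector"
  assumes "finite E" "T \<subseteq> E"
    and same: "\<And>X. X \<subseteq> E \<Longrightarrow> independent_family u X \<longleftrightarrow> independent_family w X"
    and ind: "independent_family u T"
    and A: "\<And>e. e \<in> E \<Longrightarrow> u e = (\<Sum>t\<in>T. A t e *\<^sub>R u t)"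
    and B: "\<And>e. e \<in> E \<Longrightarrow> w e = (\<Sum>t\<in>T. B t e *\<^sub>R w t)"
    and ent: "\<And>t e. t \<in> T \<Longrightarrow> e \<in> E \<Longrightarrow> A t e \<in> {-1, 0, 1} \<and> B t e \<in> {-1, 0, 1}"
  shows "\<exists>r s. (\<forall>t. r t \<in> {-1, 1}) \<and> (\<forall>e. s e \<in> {-1, 1}) \<and>
    (\<forall>e\<in>E. (\<Sum>t\<in>T. (A t e * r t) *\<^sub>R w t) = s e *\<^sub>R w e)"
proof -
  have finT: "finite T" using assms(1,2) finite_subset by blast
  have indw: "independent_family w T" using ind same \<open>T \<subseteq> E\<close> by simp
  have "\<exists>r s. (\<forall>t. r t \<in> {-1, 1}) \<and> (\<forall>e. s e \<in> {-1, 1}) \<and>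
    (\<forall>t\<in>T. \<forall>e\<in>E - T. B t e = r t * s e * A t e)"
  proof (rule sign_equivalent_if_same_singular_minors)
    fix R C assume RC: "R \<subseteq> T" "C \<subseteq> E - T"
    then have C: "finite C" "C \<inter> T = {}" "C \<union> (T - R) \<subseteq> E"
      using assms(1,2) finite_subset[of C E] by auto
    have "singular_minor A R C \<longleftrightarrow> \<not> independent_family u (C \<union> (T - R))"
      by (rule singular_minor_iff_dependent) (use ind finT C RC A in auto)
    moreover have "singular_minor B R C \<longleftrightarrow> \<not> independent_family w (C \<union> (T - R))"
      by (rule singular_minor_iff_dependent) (use indw finT C RC B in auto)
    ultimately show "singular_minor A R C \<longleftrightarrow> singular_minor B R C" using same C by simp
  qed (use assms(1) ent in auto)
  then obtain r s where r: "\<And>t. r t \<in> {-1, 1}" and s: "\<And>e. s e \<in> {-1, 1}"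
    and rs: "\<And>t e. t \<in> T \<Longrightarrow> e \<in> E - T \<Longrightarrow> B t e = r t * s e * A t e" by metis
  \<comment> \<open>A basis element has a unit column, so its sign is the row sign.\<close>
  define s' where "s' = (\<lambda>e. if e \<in> T then r e else s e)"
  have "(\<Sum>t\<in>T. (A t e * r t) *\<^sub>R w t) = s' e *\<^sub>R w e" if e: "e \<in> E" for e
  proof (cases "e \<in> T")
    case True
    have "A t e = (if t \<in> {e} then 1 else 0)" if "t \<in> T" for t
    proof (rule independent_family_coeff_unique[OF ind _ that])
      show "(\<Sum>t\<in>T. A t e *\<^sub>R u t) = (\<Sum>t\<in>T. (if t \<in> {e} then 1 else 0) *\<^sub>R u t)"
        by (subst sum_scaleR_zero_outside) (use finT True A[OF e] in auto)
    qed
    then have "(\<Sum>t\<in>T. (A t e * r t) *\<^sub>R w t) = (\<Sum>t\<in>T. (if t \<in> {e} then r t else 0) *\<^sub>R w t)"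
      by (intro sum.cong) auto
    also have "\<dots> = r e *\<^sub>R w e"
      by (subst sum_scaleR_zero_outside) (use finT True in auto)
    finally show ?thesis using True by (simp add: s'_def)
  next
    case False
    have "A t e * r t = s e * B t e" if "t \<in> T" for t
      using rs[of t e] that e False r[of t] s[of e] by auto
    then have "(\<Sum>t\<in>T. (A t e * r t) *\<^sub>R w t) = (\<Sum>t\<in>T. s e *\<^sub>R B t e *\<^sub>R w t)"
      by (intro sum.cong) auto
    also have "\<dots> = s e *\<^sub>R w e" by (simp only: scaleR_sum_right[symmetric] B[OF e, symmetric])
    finally show ?thesis using False by (simp add: s'_def)
  qed
  moreover have "s' e \<in> {-1, 1}" for e using r[of e] s[of e] by (simp add: s'_def)
  ultimately show ?thesis using r by (intro exI[of _ r] exI[of _ s']) blast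
qed

section \<open>Forests and edge vectors\<close>

definition oriented_edges :: "('v::finite set \<Rightarrow> real ^ 'v) \<Rightarrow> 'v set set \<Rightarrow> bool" where
  "oriented_edges u E \<longleftrightarrow>
     (\<forall>e\<in>E. \<exists>i j. i \<noteq> j \<and> e = {i, j} \<and> u e = axis i 1 - axis j 1)"

lemma oriented_edgesE:
  assumes "oriented_edges u E" "e \<in> E"
  obtains i j where "i \<noteq> j" "e = {i, j}" "u e = axis i 1 - axis j 1"
  using assms unfolding oriented_edges_def by blast

lemma ex_oriented_edges:
  assumes "simple_graph E"
  shows "\<exists>u. oriented_edges u E"
proof -
  have "\<forall>e\<in>E. \<exists>x. \<exists>i j. i \<noteq> j \<and> e = {i, j} \<and> x = (axis i 1 - axis j 1 :: real ^ 'a)"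
    using assms unfolding simple_graph_def by (metis card_2_iff)
  then show ?thesis unfolding oriented_edges_def by (rule bchoice)
qed

lemma edge_eq_support:
  assumes "oriented_edges u E" "e \<in> E"
  shows "e = {k. u e $ k \<noteq> 0}"
  by (rule oriented_edgesE[OF assms]) (auto simp: axis_def split: if_splits)

text \<open>Negation keeps the support, and the support is the edge.\<close>

lemma edge_vector_determines_edge:
  assumes "oriented_edges u E" "e \<in> E" "e' \<in> E" "u e = u e' \<or> u e = - u e'"
  shows "e = e'"
proof -
  have "{k. u e $ k \<noteq> 0} = {k. u e' $ k \<noteq> 0}" using assms(4) by auto
  then show ?thesis using edge_eq_support[OF assms(1)] assms(2,3) by metis
qed

text \<open>Induction along the walk: a step to a vertex already on the path truncates the path
  there, any other step extends it.\<close>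

lemma distinct_path_if_reachable:
  assumes "(\<lambda>x y. {x, y} \<in> Y)\<^sup>*\<^sup>* i x"
  shows "\<exists>vs. vs \<noteq> [] \<and> distinct vs \<and> vs ! 0 = i \<and> last vs = x \<and>
    (\<forall>m. Suc m < length vs \<longrightarrow> {vs ! m, vs ! Suc m} \<in> Y)"
  using assms
proof (induction)
  case base
  show ?case by (rule exI[of _ "[i]"]) simp
next
  case (step y z)
  then obtain vs where vs: "vs \<noteq> []" "distinct vs" "vs ! 0 = i" "last vs = y"
    "\<forall>m. Suc m < length vs \<longrightarrow> {vs ! m, vs ! Suc m} \<in> Y" by blast
  show ?case
  proof (cases "z \<in> set vs")
    case True
    then obtain m where m: "m < length vs" "vs ! m = z" by (auto simp: in_set_conv_nth)
    then have "last (take (Suc m) vs) = z" by (simp add: take_Suc_conv_app_nth)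
    then show ?thesis using vs m by (intro exI[of _ "take (Suc m) vs"]) auto
  next
    case False
    have "{(vs @ [z]) ! m, (vs @ [z]) ! Suc m} \<in> Y" if "Suc m < length (vs @ [z])" for m
    proof (cases "Suc m < length vs")
      case True
      then show ?thesis using vs(5) by (simp add: nth_append)
    next
      case 2: False
      then have "Suc m = length vs" using that by simp
      then have "vs ! m = y" using vs(1,4) by (metis diff_Suc_1 last_conv_nth)
      then show ?thesis using \<open>Suc m = length vs\<close> step.hyps(2) by (simp add: nth_append)
    qed
    then show ?thesis using vs False by (intro exI[of _ "vs @ [z]"]) (auto simp: nth_append)
  qed
qed

text \<open>\<open>S\<close> is the component of \<open>i\<close> after deletion of the edge. A path
  from \<open>i\<close> to \<open>j\<close> inside it would close up to a cycle.\<close>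

lemma forest_edge_cut:
  assumes "\<nexists>vs. is_cycle X vs" "{i, j} \<in> X" "i \<noteq> j"
  shows "\<exists>S. i \<in> S \<and> j \<notin> S \<and> (\<forall>x y. {x, y} \<in> X - {{i, j}} \<longrightarrow> (x \<in> S \<longleftrightarrow> y \<in> S))"
proof -
  let ?r = "\<lambda>x y. {x, y} \<in> X - {{i, j}}"
  define S where "S = {x. ?r\<^sup>*\<^sup>* i x}"
  have "j \<notin> S"
  proof
    assume "j \<in> S"
    then obtain vs where vs: "vs \<noteq> []" "distinct vs" "vs ! 0 = i" "last vs = j"
      "\<And>m. Suc m < length vs \<Longrightarrow> {vs ! m, vs ! Suc m} \<in> X - {{i, j}}"
      using distinct_path_if_reachable[of "X - {{i, j}}" i j] unfolding S_def by blast
    have lst: "vs ! (length vs - 1) = j" using vs(1,4) by (simp add: last_conv_nth)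
    \<comment> \<open>A path with two vertices would be the deleted edge itself, so there are the
      three vertices that a cycle requires.\<close>
    have "length vs \<noteq> 0" "length vs \<noteq> 1" "length vs \<noteq> 2"
      using vs(1,3) lst vs(5)[of 0] assms(3) by auto
    then have len: "length vs \<ge> 3" by linarith
    have "{vs ! m, vs ! (Suc m mod length vs)} \<in> X" if "m < length vs" for m
    proof (cases "Suc m < length vs")
      case True
      then show ?thesis using vs(5)[of m] by simp
    next
      case False
      then have "Suc m = length vs" using that by simp
      then have "vs ! m = j" "Suc m mod length vs = 0" using lst by (metis diff_Suc_1, simp)
      then show ?thesis using vs(3) assms(2) by (simp add: insert_commute)
    qed
    then have "is_cycle X vs" using len vs(2) by (simp add: is_cycle_def)
    then show False using assms(1) by blast
  qed
  moreover have "i \<in> S" by (simp add: S_def)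
  moreover have "x \<in> S \<longleftrightarrow> y \<in> S" if "?r x y" for x y
  proof -
    have "?r y x" using that by (simp add: insert_commute)
    then show ?thesis using that unfolding S_def mem_Collect_eq
      by (meson rtranclp.rtrancl_into_rtrancl)
  qed
  ultimately show ?thesis by blast
qed

section \<open>Reading forest coordinates off cuts\<close>

definition cut_sum :: "'v::finite set \<Rightarrow> real ^ 'v \<Rightarrow> real" where
  "cut_sum S x = (\<Sum>k\<in>S. x $ k)"

lemma linear_cut_sum: "linear (cut_sum S)"
  by (rule linearI) (simp_all add: cut_sum_def sum.distrib sum_distrib_left)

lemma cut_sum_edge:
  "cut_sum S (axis i 1 - axis j 1) = (if i \<in> S then 1 else 0) - (if j \<in> S then 1 else 0)"
proof -
  have "(\<Sum>k\<in>S. (axis i (1::real)) $ k) = (if i \<in> S then 1 else 0)" for i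
    by (simp add: axis_def if_distrib cong: if_cong)
  then show ?thesis by (simp add: cut_sum_def sum_subtractf)
qed

text \<open>Only \<open>t\<close> crosses the cut obtained by deleting it from \<open>X\<close>, so
  \<open>u t\<close> has cut sum 1 and the other vectors have cut sum 0. \<open>S\<close> is chosen
  before the coefficients, so it gives a genuine coordinate functional.\<close>

lemma forest_coordinate_functional:
  assumes "oriented_edges u E" "X \<subseteq> E" "\<nexists>vs. is_cycle X vs" "t \<in> X"
  shows "\<exists>S. \<forall>a. a t = cut_sum S (\<Sum>f\<in>X. a f *\<^sub>R u f)"
proof -
  obtain i j where ij: "i \<noteq> j" "t = {i, j}" "u t = axis i 1 - axis j 1"
    using oriented_edgesE assms by blast
  obtain S where S: "i \<in> S" "j \<notin> S" "\<And>x y. {x, y} \<in> X - {t} \<Longrightarrow> x \<in> S \<longleftrightarrow> y \<in> S"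
    using forest_edge_cut[of X i j] assms(3,4) ij by blast
  have z: "cut_sum S (u f) = 0" if f: "f \<in> X - {t}" for f
  proof -
    obtain x y where xy: "f = {x, y}" "u f = axis x 1 - axis y 1"
      using oriented_edgesE[OF assms(1), of f] f assms(2) by blast
    then have "x \<in> S \<longleftrightarrow> y \<in> S" using S(3) f by simp
    then show ?thesis by (simp add: xy(2) cut_sum_edge)
  qed
  have "cut_sum S (\<Sum>f\<in>X. a f *\<^sub>R u f) = a t" for a
  proof -
    have "cut_sum S (\<Sum>f\<in>X. a f *\<^sub>R u f) = (\<Sum>f\<in>X. a f * cut_sum S (u f))"
      by (simp add: linear_sum[OF linear_cut_sum] linear_scale[OF linear_cut_sum])
    also have "\<dots> = (\<Sum>f\<in>{t}. a f * cut_sum S (u f))"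
      by (rule sum.mono_neutral_right) (use z assms(4) in auto)
    also have "\<dots> = a t" using ij(3) S(1,2) by (simp add: cut_sum_edge)
    finally show ?thesis .
  qed
  then show ?thesis by (intro exI[of _ S]) simp
qed

text \<open>Signed along the direction of travel, the edge vectors telescope to 0 around the
  cycle.\<close>

lemma cycle_imp_dependent:
  assumes u: "oriented_edges u E" and "X \<subseteq> E" "is_cycle X vs"
  shows "\<not> independent_family u X"
proof
  assume ind: "independent_family u X"
  define n where "n = length vs"
  have n: "n \<ge> 3" "distinct vs" "\<And>m. m < n \<Longrightarrow> {vs ! m, vs ! (Suc m mod n)} \<in> X"
    using assms(3) by (auto simp: is_cycle_def n_def)
  define ed where "ed = (\<lambda>m. {vs ! m, vs ! (Suc m mod n)})"
  have inj: "vs ! a = vs ! b \<longleftrightarrow> a = b" if "a < n" "b < n" for a b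
    using n(2) that by (simp add: nth_eq_iff_index_eq n_def)
  \<comment> \<open>The closing edge occurs only once. Here length at least 3 matters: with two
    vertices both edges would coincide.\<close>
  have ed_ne: "ed m \<noteq> ed (n - 1)" if "m < n - 1" for m
  proof
    assume eq: "ed m = ed (n - 1)"
    have "ed m = {vs ! m, vs ! Suc m}" "ed (n - 1) = {vs ! (n - 1), vs ! 0}"
      using that by (auto simp: ed_def)
    then have "(vs ! m = vs ! (n - 1) \<and> vs ! Suc m = vs ! 0) \<or> (vs ! m = vs ! 0 \<and> vs ! Suc m = vs ! (n - 1))"
      using eq by (simp add: doubleton_eq_iff)
    moreover have "vs ! m \<noteq> vs ! (n - 1)" using inj[of m "n - 1"] that by simp
    ultimately have "m = 0 \<and> Suc m = n - 1" using inj[of m 0] inj[of "Suc m" "n - 1"] that by simp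
    then show False using n(1) by linarith
  qed
  have "\<exists>\<epsilon>\<in>{-1, 1::real}. axis (vs ! m) 1 - axis (vs ! (Suc m mod n)) 1 = \<epsilon> *\<^sub>R u (ed m)" if m: "m < n" for m
  proof -
    have "ed m \<in> E" using n(3)[OF m] assms(2) by (auto simp: ed_def)
    then obtain i j where "ed m = {i, j}" "u (ed m) = axis i 1 - axis j 1" using u oriented_edgesE by blast
    then show ?thesis unfolding ed_def by (auto simp: doubleton_eq_iff)
  qed
  then have "\<forall>m\<in>{..<n}. \<exists>\<epsilon>. \<epsilon> \<in> {-1, 1::real} \<and> axis (vs ! m) 1 - axis (vs ! (Suc m mod n)) 1 = \<epsilon> *\<^sub>R u (ed m)"
    by blast
  then obtain \<epsilon> where \<epsilon>: "\<And>m. m < n \<Longrightarrow> \<epsilon> m \<in> {-1, 1::real} \<and>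
      axis (vs ! m) 1 - axis (vs ! (Suc m mod n)) 1 = \<epsilon> m *\<^sub>R u (ed m)"
    by (metis lessThan_iff)
  \<comment> \<open>Coefficients belong to edges, not positions, so the signs of all positions with
    the same edge are collected. The closing edge receives a single sign, hence a nonzero
    coefficient.\<close>
  define z where "z = (\<lambda>e. \<Sum>m | m < n \<and> ed m = e. \<epsilon> m)"
  have edX: "ed ` {..<n} \<subseteq> X" using n(3) by (auto simp: ed_def)
  have "(\<Sum>e\<in>X. z e *\<^sub>R u e) = (\<Sum>e\<in>X. \<Sum>m | m \<in> {..<n} \<and> ed m = e. \<epsilon> m *\<^sub>R u (ed m))"
    by (simp add: z_def scaleR_sum_left)
  also have "\<dots> = (\<Sum>m<n. \<epsilon> m *\<^sub>R u (ed m))"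
    by (rule sum.group) (use edX in auto)
  also have "\<dots> = (\<Sum>m<n. axis (vs ! m) 1 - axis (vs ! (Suc m mod n)) 1)"
    by (rule sum.cong) (simp_all add: \<epsilon>)
  also have "\<dots> = 0"
  proof -
    obtain l where l: "n = Suc l" using n(1) by (cases n) auto
    have "(\<Sum>m<n. axis (vs ! (Suc m mod n)) 1 :: real ^ 'a) = (\<Sum>m<l. axis (vs ! Suc m) 1) + axis (vs ! 0) 1"
      by (simp add: l)
    also have "\<dots> = (\<Sum>m<n. axis (vs ! m) 1)" unfolding l sum.lessThan_Suc_shift by simp
    finally show ?thesis by (simp add: sum_subtractf)
  qed
  finally have "z (ed (n - 1)) = 0"
    by (rule independent_familyD[OF ind]) (use edX n(1) in auto)
  moreover have "{m. m < n \<and> ed m = ed (n - 1)} = {n - 1}"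
  proof -
    have "m = n - 1" if "m < n" "ed m = ed (n - 1)" for m
      using ed_ne[of m] that by fastforce
    then show ?thesis using n(1) by auto
  qed
  ultimately show False using \<epsilon>[of "n - 1"] n(1) by (auto simp: z_def)
qed

lemma forest_iff_independent:
  assumes "oriented_edges u E" "X \<subseteq> E"
  shows "(\<nexists>vs. is_cycle X vs) \<longleftrightarrow> independent_family u X"
proof
  assume ac: "\<nexists>vs. is_cycle X vs"
  have "a t = 0" if z: "(\<Sum>f\<in>X. a f *\<^sub>R u f) = 0" and t: "t \<in> X" for a t
  proof -
    obtain S where "\<forall>a. a t = cut_sum S (\<Sum>f\<in>X. a f *\<^sub>R u f)"
      using forest_coordinate_functional[OF assms ac t] by blast
    then have "a t = cut_sum S 0" using z by metis
    then show ?thesis by (simp add: linear_0[OF linear_cut_sum])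
  qed
  then show "independent_family u X" unfolding independent_family_def by blast
qed (use cycle_imp_dependent[OF assms] in blast)

text \<open>The coordinate is the cut sum of one edge vector, which crosses the cut in one
  direction, in the other, or not at all.\<close>

lemma forest_coordinate_of_edge:
  assumes "oriented_edges u E" "X \<subseteq> E" "independent_family u X" "t \<in> X" "e \<in> E"
    and "u e = (\<Sum>f\<in>X. a f *\<^sub>R u f)"
  shows "a t \<in> {-1, 0, 1}"
proof -
  obtain S where S: "a t = cut_sum S (u e)"
    using forest_coordinate_functional[OF assms(1,2) _ assms(4)] forest_iff_independent[OF assms(1,2)]
      assms(3,6) by metis
  obtain i j where "u e = axis i 1 - axis j 1" using oriented_edgesE[OF assms(1,5)] by blast
  then show ?thesis using S by (auto simp: cut_sum_edge)
qed

text \<open>Cut sums of integral vectors are integers. With \<open>integral_combination\<close>, the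
  edge vectors of a forest form a lattice basis of the integral points in their span.\<close>

lemma forest_coordinate_integral:
  assumes "oriented_edges u E" "X \<subseteq> E" "independent_family u X" "t \<in> X"
    and "\<forall>k. (\<Sum>f\<in>X. a f *\<^sub>R u f) $ k \<in> \<int>"
  shows "a t \<in> \<int>"
proof -
  obtain S where S: "a t = cut_sum S (\<Sum>f\<in>X. a f *\<^sub>R u f)"
    using forest_coordinate_functional[OF assms(1,2) _ assms(4)] forest_iff_independent[OF assms(1,2)]
      assms(3) by metis
  have "cut_sum S (\<Sum>f\<in>X. a f *\<^sub>R u f) \<in> \<int>" unfolding cut_sum_def using assms(5) by (intro Ints_sum) auto
  then show ?thesis using S by auto
qed

lemma integral_combination:
  assumes "oriented_edges u E" "X \<subseteq> E" "\<forall>t\<in>X. a t \<in> \<int>"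
  shows "(\<Sum>f\<in>X. a f *\<^sub>R u f) $ k \<in> \<int>"
proof -
  have "u f $ k \<in> \<int>" if "f \<in> X" for f
    by (rule oriented_edgesE[OF assms(1), of f]) (use assms(2) that in \<open>auto simp: axis_def\<close>)
  then show ?thesis using assms(3) by (auto intro!: Ints_sum Ints_mult)
qed

section \<open>Vertices of the symmetric edge polytope\<close>

definition edge_vectors :: "('v::finite set \<Rightarrow> real ^ 'v) \<Rightarrow> 'v set set \<Rightarrow> (real ^ 'v) set" where
  "edge_vectors u E = u ` E \<union> (\<lambda>e. - u e) ` E"

lemma edge_vectorsE:
  assumes "x \<in> edge_vectors u E"
  obtains e \<epsilon> where "e \<in> E" "\<epsilon> \<in> {-1, 1::real}" "x = \<epsilon> *\<^sub>R u e"
proof -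
  from assms consider e where "e \<in> E" "x = 1 *\<^sub>R u e" | e where "e \<in> E" "x = (-1) *\<^sub>R u e"
    by (auto simp: edge_vectors_def)
  then show thesis by cases (use that in blast)+
qed

lemma edge_vectors_minus: "x \<in> edge_vectors u E \<Longrightarrow> - x \<in> edge_vectors u E"
  by (auto simp: edge_vectors_def)

lemma finite_edge_vectors: "finite (edge_vectors u (E :: 'v::finite set set))"
  by (simp add: edge_vectors_def)

lemma edge_vector_cases:
  assumes "oriented_edges u E" "x \<in> edge_vectors u E"
  obtains i j where "i \<noteq> j" "{i, j} \<in> E" "x = axis i 1 - axis j 1"
proof -
  from assms(2) consider e where "e \<in> E" "x = u e" | e where "e \<in> E" "x = - u e"
    by (auto simp: edge_vectors_def)
  then show thesis
  proof cases
    case 1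
    with oriented_edgesE[OF assms(1)] show thesis using that by metis
  next
    case 2
    from oriented_edgesE[OF assms(1) 2(1)] obtain i j where "i \<noteq> j" "e = {i, j}" "u e = axis i 1 - axis j 1" .
    then show thesis using that[of j i] 2 by (simp add: insert_commute)
  qed
qed

lemma symmetric_edge_polytope_eq:
  assumes "oriented_edges u E"
  shows "symmetric_edge_polytope E = convex hull (edge_vectors u E)"
proof -
  have "{x. \<exists>i j. {i, j} \<in> E \<and> (x = axis i 1 - axis j 1 \<or> x = - (axis i 1 - axis j 1))}
      = edge_vectors u E" (is "?L = _")
  proof
    show "edge_vectors u E \<subseteq> ?L"
      by (rule subsetI, erule edge_vector_cases[OF assms]) blast
    show "?L \<subseteq> edge_vectors u E"
    proof
      fix x assume "x \<in> ?L"
      then obtain i j where ij: "{i, j} \<in> E" "x = axis i 1 - axis j 1 \<or> x = - (axis i 1 - axis j 1)" by blast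
      obtain a b where "a \<noteq> b" "{i, j} = {a, b}" "u {i, j} = axis a 1 - axis b 1"
        by (rule oriented_edgesE[OF assms ij(1)])
      then have "u {i, j} = axis i 1 - axis j 1 \<or> u {i, j} = - (axis i 1 - axis j 1)"
        unfolding doubleton_eq_iff by fastforce
      then have "x = u {i, j} \<or> x = - u {i, j}" using ij(2) by fastforce
      then show "x \<in> edge_vectors u E" using ij(1) by (auto simp: edge_vectors_def)
    qed
  qed
  then show ?thesis by (simp add: symmetric_edge_polytope_def)
qed

text \<open>The vertex \<open>axis i 1 - axis j 1\<close> is separated from the other edge vectors by the
  functional that it represents.\<close>

lemma extreme_points_edge_polytope:
  assumes "oriented_edges u E"
  shows "{x. x extreme_point_of (convex hull (edge_vectors u E))} = edge_vectors u E"
proof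
  show "{x. x extreme_point_of (convex hull (edge_vectors u E))} \<subseteq> edge_vectors u E"
    using extreme_point_of_convex_hull by blast
  show "edge_vectors u E \<subseteq> {x. x extreme_point_of (convex hull (edge_vectors u E))}"
  proof
    fix x assume x: "x \<in> edge_vectors u E"
    then obtain i j where "{i, j} \<in> E" and ij: "i \<noteq> j" "x = axis i 1 - axis j 1"
      using edge_vector_cases[OF assms] by metis
    have val: "x \<bullet> (axis a 1 - axis b 1) = (if a = i then 1 else 0) - (if a = j then 1 else 0)
        - ((if b = i then 1 else 0) - (if b = j then 1 else 0))" for a b
      unfolding ij(2) by (auto simp: inner_diff_left inner_diff_right inner_axis_axis)
    have "edge_vectors u E - {x} \<subseteq> {y. x \<bullet> y \<le> 1}"
    proof
      fix y assume y: "y \<in> edge_vectors u E - {x}"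
      then have "y \<in> edge_vectors u E" by simp
      then obtain a b where ab: "a \<noteq> b" "{a, b} \<in> E" "y = axis a 1 - axis b 1"
        by (rule edge_vector_cases[OF assms])
      \<comment> \<open>Only this pair would reach the value 2 that \<open>x\<close> takes on
        itself.\<close>
      then have "\<not> (a = i \<and> b = j)" using y ij by auto
      then show "y \<in> {y. x \<bullet> y \<le> 1}" using ab by (auto simp: val)
    qed
    then have "convex hull (edge_vectors u E - {x}) \<subseteq> {y. x \<bullet> y \<le> 1}"
      by (rule hull_minimal) (rule convex_halfspace_le)
    moreover have "x \<bullet> x = 2" using val[of i j] ij by simp
    ultimately have "x \<notin> convex hull (edge_vectors u E - {x})" by auto
    then have "x extreme_point_of (convex hull (insert x (edge_vectors u E - {x})))"
      by (rule extreme_point_of_convex_hull_insert[rotated]) (simp add: finite_edge_vectors)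
    then show "x \<in> {x. x extreme_point_of (convex hull (edge_vectors u E))}"
      using x by (simp add: insert_absorb)
  qed
qed

section \<open>Affine maps, extreme points and affine hulls\<close>

lemma affine_map_onD:
  "affine_map_on S f \<Longrightarrow> x \<in> S \<Longrightarrow> y \<in> S \<Longrightarrow> a + b = 1 \<Longrightarrow>
    f (a *\<^sub>R x + b *\<^sub>R y) = a *\<^sub>R f x + b *\<^sub>R f y"
  by (simp add: affine_map_on_def)

text \<open>An injective affine map respects open segments. Injectivity is available on
  \<open>S\<close> only, and convexity of \<open>P\<close> keeps the points of a segment
  there.\<close>

lemma affine_extreme_point_iff:
  assumes aff: "affine_map_on S f" and inj: "inj_on f S" and "P \<subseteq> S" "convex P" "x \<in> P"
  shows "x extreme_point_of P \<longleftrightarrow> f x extreme_point_of (f ` P)"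
proof -
  have seg: "x \<in> open_segment a b \<longleftrightarrow> f x \<in> open_segment (f a) (f b)" if "a \<in> P" "b \<in> P" for a b
  proof -
    have "f ((1 - t) *\<^sub>R a + t *\<^sub>R b) = (1 - t) *\<^sub>R f a + t *\<^sub>R f b" for t
      by (rule affine_map_onD[OF aff]) (use that assms(3) in auto)
    moreover have "x = (1 - t) *\<^sub>R a + t *\<^sub>R b \<longleftrightarrow> f x = f ((1 - t) *\<^sub>R a + t *\<^sub>R b)" if "0 < t" "t < 1" for t
    proof -
      have "(1 - t) *\<^sub>R a + t *\<^sub>R b \<in> P"
        using \<open>convex P\<close> \<open>a \<in> P\<close> \<open>b \<in> P\<close> that by (intro convexD) auto
      then show ?thesis using inj assms(3,5) by (metis inj_on_eq_iff subsetD)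
    qed
    moreover have "a = b \<longleftrightarrow> f a = f b" using inj that assms(3) by (metis inj_on_eq_iff subsetD)
    ultimately show ?thesis unfolding in_segment by metis
  qed
  then show ?thesis using \<open>x \<in> P\<close> unfolding extreme_point_of_def by auto
qed

text \<open>The origin is the midpoint of opposite vertices, so the affine hull is a linear
  subspace. Without edges the hull would be empty, whereas the span is the zero space.\<close>

lemma affine_hull_edge_vectors:
  assumes "E \<noteq> {}"
  shows "affine hull (convex hull (edge_vectors u E)) = span (u ` E)"
proof -
  obtain e where e: "e \<in> E" using assms by blast
  let ?V = "edge_vectors u E"
  have "midpoint (u e) (- u e) \<in> convex hull ?V"
    unfolding midpoint_def scaleR_right_distrib
    by (rule convexD[OF convex_convex_hull]) (use e in \<open>auto simp: edge_vectors_def hull_inc\<close>)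
  then have "0 \<in> affine hull ?V"
    using convex_hull_subset_affine_hull by (auto simp: midpoint_def)
  then have "affine hull ?V = span ?V" by (rule affine_hull_span_0)
  also have "\<dots> = span (u ` E)"
    unfolding span_eq by (auto simp: edge_vectors_def span_base span_neg)
  finally show ?thesis by simp
qed

section \<open>Matroid isomorphisms and unimodular equivalences\<close>

lemma sum_reindex_inv_into:
  assumes "inj_on \<phi> T"
  shows "(\<Sum>t\<in>T. b t *\<^sub>R w (\<phi> t)) = (\<Sum>f\<in>\<phi> ` T. b (the_inv_into T \<phi> f) *\<^sub>R w f)"
  unfolding sum.reindex[OF assms] by (rule sum.cong) (auto simp: the_inv_into_f_f[OF assms])

lemma independent_family_image:
  assumes "inj_on \<phi> X"
  shows "independent_family w (\<phi> ` X) \<longleftrightarrow> independent_family (\<lambda>e. w (\<phi> e)) X"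
proof
  assume ind: "independent_family w (\<phi> ` X)"
  show "independent_family (\<lambda>e. w (\<phi> e)) X"
    unfolding independent_family_def
  proof (intro allI impI ballI)
    fix z e assume z: "(\<Sum>e\<in>X. z e *\<^sub>R w (\<phi> e)) = 0" and e: "e \<in> X"
    then show "z e = 0"
      using independent_familyD[OF ind, of "\<lambda>f. z (the_inv_into X \<phi> f)" "\<phi> e"] e
      by (simp add: sum_reindex_inv_into[OF assms] the_inv_into_f_f[OF assms])
  qed
next
  assume ind: "independent_family (\<lambda>e. w (\<phi> e)) X"
  show "independent_family w (\<phi> ` X)"
    unfolding independent_family_def
  proof (intro allI impI ballI)
    fix z f assume z: "(\<Sum>f\<in>\<phi> ` X. z f *\<^sub>R w f) = 0" and "f \<in> \<phi> ` X"
    then obtain e where e: "e \<in> X" "f = \<phi> e" by blast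
    have "(\<Sum>e\<in>X. z (\<phi> e) *\<^sub>R w (\<phi> e)) = 0" using z by (simp add: sum.reindex[OF assms])
    then show "z f = 0" using independent_familyD[OF ind, of "\<lambda>e. z (\<phi> e)" e] e by simp
  qed
qed

lemma graphic_matroid_isomorphic_iff:
  assumes u: "oriented_edges u G" and w: "oriented_edges w H"
  shows "matroid_isomorphic (graphic_matroid G) (graphic_matroid H) \<longleftrightarrow>
    (\<exists>\<phi>. bij_betw \<phi> G H \<and>
      (\<forall>X\<subseteq>G. independent_family u X \<longleftrightarrow> independent_family (\<lambda>e. w (\<phi> e)) X))"
proof -
  have "indep (graphic_matroid H) (\<phi> ` X) \<longleftrightarrow> independent_family (\<lambda>e. w (\<phi> e)) X"
    if "bij_betw \<phi> G H" "X \<subseteq> G" for \<phi> X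
  proof -
    have "\<phi> ` X \<subseteq> H" "inj_on \<phi> X"
      using that by (auto simp: bij_betw_def intro: inj_on_subset)
    then show ?thesis
      using forest_iff_independent[OF w, of "\<phi> ` X"] independent_family_image[of \<phi> X w]
      by (simp add: graphic_matroid_def)
  qed
  moreover have "indep (graphic_matroid G) X \<longleftrightarrow> independent_family u X" if "X \<subseteq> G" for X
    using forest_iff_independent[OF u that] that by (simp add: graphic_matroid_def)
  moreover have "ground (graphic_matroid G) = G" "ground (graphic_matroid H) = H"
    by (simp_all add: graphic_matroid_def)
  ultimately show ?thesis unfolding matroid_isomorphic_def by auto
qed

section \<open>From unimodular equivalences to matroid isomorphisms\<close>

lemma affine_map_on_subspace_linear:
  assumes aff: "affine_map_on S f" and S: "subspace S" and f0: "f 0 = 0"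
  shows "x \<in> S \<Longrightarrow> f (c *\<^sub>R x) = c *\<^sub>R f x"
    and "x \<in> S \<Longrightarrow> y \<in> S \<Longrightarrow> f (x + y) = f x + f y"
    and "(\<And>e. e \<in> X \<Longrightarrow> v e \<in> S) \<Longrightarrow> f (\<Sum>e\<in>X. z e *\<^sub>R v e) = (\<Sum>e\<in>X. z e *\<^sub>R f (v e))"
proof -
  show scale: "f (c *\<^sub>R x) = c *\<^sub>R f x" if "x \<in> S" for x c
  proof -
    \<comment> \<open>Scaling is an affine combination with the fixed point 0.\<close>
    have "f (c *\<^sub>R x + (1 - c) *\<^sub>R 0) = c *\<^sub>R f x + (1 - c) *\<^sub>R f 0"
      by (rule affine_map_onD[OF aff]) (use that subspace_0[OF S] in auto)
    then show ?thesis using f0 by simp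
  qed
  show add: "f (x + y) = f x + f y" if "x \<in> S" "y \<in> S" for x y
  proof -
    \<comment> \<open>The sum is the midpoint of the doubled vectors.\<close>
    have "f ((1/2) *\<^sub>R (2 *\<^sub>R x) + (1/2) *\<^sub>R (2 *\<^sub>R y)) = (1/2) *\<^sub>R f (2 *\<^sub>R x) + (1/2) *\<^sub>R f (2 *\<^sub>R y)"
      by (rule affine_map_onD[OF aff]) (use that in \<open>auto intro: subspace_scale[OF S]\<close>)
    then show ?thesis using scale that by simp
  qed
  show "f (\<Sum>e\<in>X. z e *\<^sub>R v e) = (\<Sum>e\<in>X. z e *\<^sub>R f (v e))" if "\<And>e. e \<in> X \<Longrightarrow> v e \<in> S"
    using that
  proof (induction X rule: infinite_finite_induct)
    case (insert e X)
    have "(\<Sum>e\<in>X. z e *\<^sub>R v e) \<in> S" using insert.prems by (intro subspace_sum[OF S] subspace_scale[OF S]) auto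
    moreover have "z e *\<^sub>R v e \<in> S" using insert.prems by (intro subspace_scale[OF S]) auto
    ultimately show ?case using insert by (simp add: add scale)
  qed (simp_all add: f0)
qed

lemma sum_edge_vectors: "(\<Sum>x\<in>edge_vectors u E. x) = 0"
proof -
  let ?s = "\<Sum>x\<in>edge_vectors u E. x"
  have "?s = (\<Sum>x\<in>edge_vectors u E. - x)"
    by (rule sum.reindex_bij_witness[of _ uminus uminus]) (auto intro: edge_vectors_minus)
  then have "?s + ?s = 0" unfolding sum_negf by (metis add.right_inverse)
  then have "2 *\<^sub>R ?s = 0" by (simp only: scaleR_2)
  then show ?thesis by simp
qed

lemma unimodular_equivalence_imp_matroid_isomorphic:
  assumes u: "oriented_edges u G" and w: "oriented_edges w H"
    and equiv: "unimodularly_equivalent (convex hull (edge_vectors u G)) (convex hull (edge_vectors w H))"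
  shows "\<exists>\<phi>. bij_betw \<phi> G H \<and>
      (\<forall>X\<subseteq>G. independent_family u X \<longleftrightarrow> independent_family (\<lambda>e. w (\<phi> e)) X)"
proof -
  let ?P = "convex hull (edge_vectors u G)" and ?Q = "convex hull (edge_vectors w H)"
  obtain f where aff: "affine_map_on (affine hull ?P) f" and inj: "inj_on f (affine hull ?P)"
    and im: "f ` ?P = ?Q"
    using equiv unfolding unimodularly_equivalent_def bij_betw_def by blast
  have sub: "?P \<subseteq> affine hull ?P" by (rule hull_subset)
  have VP: "edge_vectors u G \<subseteq> ?P" by (rule hull_subset)
  have ext: "x extreme_point_of ?P \<longleftrightarrow> f x extreme_point_of ?Q" if "x \<in> ?P" for x
    using affine_extreme_point_iff[OF aff inj sub convex_convex_hull that] im by simp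
  \<comment> \<open>Extreme points correspond under \<open>f\<close>, and on both sides they are the
    edge vectors.\<close>
  have fV: "f ` edge_vectors u G = edge_vectors w H"
  proof
    show "f ` edge_vectors u G \<subseteq> edge_vectors w H"
      using ext VP extreme_points_edge_polytope[OF u] extreme_points_edge_polytope[OF w] by blast
    show "edge_vectors w H \<subseteq> f ` edge_vectors u G"
    proof
      fix y assume "y \<in> edge_vectors w H"
      then have y: "y extreme_point_of ?Q" using extreme_points_edge_polytope[OF w] by blast
      then obtain x where "x \<in> ?P" "y = f x" using im unfolding extreme_point_of_def by blast
      then show "y \<in> f ` edge_vectors u G"
        using y ext extreme_points_edge_polytope[OF u] by blast
    qed
  qed
  show ?thesis
  proof (cases "G = {}")
    case True
    then have "H = {}" using fV by (auto simp: edge_vectors_def)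
    then show ?thesis using True by (intro exI[of _ "\<lambda>_. {}"]) (auto simp: independent_family_def bij_betw_def)
  next
    case False
    let ?S = "span (u ` G)"
    have S: "affine hull ?P = ?S" using affine_hull_edge_vectors[OF False] .
    note aff = aff[unfolded S] and inj = inj[unfolded S]
    have VS: "edge_vectors u G \<subseteq> ?S" using VP sub S by blast
    \<comment> \<open>Each vertex satisfies \<open>f x + f (- x) = 2 *\<^sub>R f 0\<close>. Summed
      over all vertices, the right side is a positive multiple of \<open>f 0\<close>, and the left
      side is twice the sum of the vertices of the image, which is 0.\<close>
    have f0: "f 0 = 0"
    proof -
      let ?V = "edge_vectors u G"
      have "f x + f (- x) = 2 *\<^sub>R f 0" if "x \<in> ?V" for x
      proof -
        have "f ((1/2) *\<^sub>R x + (1/2) *\<^sub>R (- x)) = (1/2) *\<^sub>R f x + (1/2) *\<^sub>R f (- x)"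
          by (rule affine_map_onD[OF aff]) (use that VS edge_vectors_minus[OF that] in auto)
        then have "f 0 = (1/2) *\<^sub>R (f x + f (- x))" by (simp add: scaleR_right_distrib)
        then show ?thesis by simp
      qed
      then have "(\<Sum>x\<in>?V. f x + f (- x)) = (\<Sum>x\<in>?V. 2 *\<^sub>R f 0)" by (intro sum.cong) auto
      moreover have "(\<Sum>x\<in>?V. f (- x)) = (\<Sum>x\<in>?V. f x)"
        by (rule sum.reindex_bij_witness[of _ uminus uminus]) (auto intro: edge_vectors_minus)
      moreover have "(\<Sum>x\<in>?V. f x) = (\<Sum>y\<in>edge_vectors w H. y)"
        unfolding fV[symmetric] using inj_on_subset[OF inj VS] by (simp add: sum.reindex)
      ultimately have "(\<Sum>x\<in>?V. 2 *\<^sub>R f 0) = 0" using sum_edge_vectors[of w H] by (simp add: sum.distrib)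
      then have "(real (card ?V) * 2) *\<^sub>R f 0 = 0" by (simp only: sum_constant_scaleR scaleR_scaleR)
      moreover have "card ?V \<noteq> 0"
        using False finite_edge_vectors[of u G] by (auto simp: edge_vectors_def)
      ultimately show ?thesis by simp
    qed
    note lin = affine_map_on_subspace_linear[OF aff subspace_span f0]
    have uS: "u e \<in> ?S" if "e \<in> G" for e using that by (simp add: span_base)
    have "\<exists>p. fst p \<in> H \<and> snd p \<in> {-1, 1::real} \<and> f (u e) = snd p *\<^sub>R w (fst p)" if "e \<in> G" for e
    proof -
      have "f (u e) \<in> edge_vectors w H" using fV that by (auto simp: edge_vectors_def)
      then show ?thesis by (elim edge_vectorsE) auto
    qed
    then obtain p where p: "\<And>e. e \<in> G \<Longrightarrow> fst (p e) \<in> H \<and> snd (p e) \<in> {-1, 1::real} \<and>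
        f (u e) = snd (p e) *\<^sub>R w (fst (p e))" by metis
    \<comment> \<open>\<open>f\<close> matches edge vectors up to sign: \<phi> records the edge and
      \<open>s\<close> the sign.\<close>
    define \<phi> s where "\<phi> = (\<lambda>e. fst (p e))" and "s = (\<lambda>e. snd (p e))"
    have \<phi>: "\<phi> e \<in> H" and s: "s e \<in> {-1, 1}" and f: "f (u e) = s e *\<^sub>R w (\<phi> e)" if "e \<in> G" for e
      using p[OF that] by (auto simp: \<phi>_def s_def)
    have ss: "s e * s e = 1" if "e \<in> G" for e using s[OF that] by auto
    have fw: "w (\<phi> e) = f (s e *\<^sub>R u e)" if "e \<in> G" for e
      using lin(1)[OF uS[OF that], of "s e"] f[OF that] ss[OF that] by simp
    have "inj_on \<phi> G"
    proof (rule inj_onI)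
      fix e e' assume e: "e \<in> G" "e' \<in> G" "\<phi> e = \<phi> e'"
      then have "f (s e *\<^sub>R u e) = f (s e' *\<^sub>R u e')" using fw by metis
      then have "s e *\<^sub>R u e = s e' *\<^sub>R u e'"
        using inj_onD[OF inj] uS e by (simp add: span_scale)
      then have "u e = u e' \<or> u e = - u e'" using s[OF e(1)] s[OF e(2)] by (auto simp: minus_equation_iff)
      then show "e = e'" using edge_vector_determines_edge[OF u] e by blast
    qed
    moreover have "\<phi> ` G = H"
    proof
      show "H \<subseteq> \<phi> ` G"
      proof
        fix h assume h: "h \<in> H"
        then have "w h \<in> f ` edge_vectors u G" unfolding fV by (simp add: edge_vectors_def)
        then obtain e \<epsilon> where e: "e \<in> G" "\<epsilon> \<in> {-1, 1::real}" "w h = f (\<epsilon> *\<^sub>R u e)"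
          by (elim imageE edge_vectorsE) auto
        then have "w h = \<epsilon> *\<^sub>R s e *\<^sub>R w (\<phi> e)" using lin(1)[OF uS] f by simp
        then have "w h = w (\<phi> e) \<or> w h = - w (\<phi> e)" using e(2) s[OF e(1)] by auto
        then show "h \<in> \<phi> ` G" using edge_vector_determines_edge[OF w h \<phi>[OF e(1)]] e(1) by blast
      qed
    qed (use \<phi> in blast)
    ultimately have "bij_betw \<phi> G H" by (simp add: bij_betw_def)
    moreover have "independent_family u X \<longleftrightarrow> independent_family (\<lambda>e. w (\<phi> e)) X" if X: "X \<subseteq> G" for X
    proof -
      have zero: "f x = 0 \<longleftrightarrow> x = 0" if "x \<in> ?S" for x
        using inj_onD[OF inj, of x 0] that span_0 f0 by auto
      \<comment> \<open>As \<open>f\<close> is linear and injective on the span, linear relations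
        correspond with coefficients changed by signs, so trivial relations correspond to trivial
        ones.\<close>
      have "(\<Sum>e\<in>X. z e *\<^sub>R u e) = 0 \<longleftrightarrow> (\<Sum>e\<in>X. (z e * s e) *\<^sub>R w (\<phi> e)) = 0" for z
      proof -
        have "(\<Sum>e\<in>X. z e *\<^sub>R u e) \<in> ?S" using uS X by (intro span_sum span_scale) auto
        moreover have "f (\<Sum>e\<in>X. z e *\<^sub>R u e) = (\<Sum>e\<in>X. z e *\<^sub>R f (u e))"
          by (rule lin(3)) (use uS X in auto)
        moreover have "\<dots> = (\<Sum>e\<in>X. (z e * s e) *\<^sub>R w (\<phi> e))"
          by (rule sum.cong) (use f X in auto)
        ultimately show ?thesis using zero by metis
      qed
      note rel = this
      have s0: "s e \<noteq> 0" if "e \<in> X" for e using s[of e] that X by auto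
      show ?thesis
      proof
        assume ind: "independent_family u X"
        show "independent_family (\<lambda>e. w (\<phi> e)) X"
          unfolding independent_family_def
        proof (intro allI impI ballI)
          fix z e assume z: "(\<Sum>e\<in>X. z e *\<^sub>R w (\<phi> e)) = 0" and e: "e \<in> X"
          have "(\<Sum>e\<in>X. (z e * s e * s e) *\<^sub>R w (\<phi> e)) = (\<Sum>e\<in>X. z e *\<^sub>R w (\<phi> e))"
            by (rule sum.cong) (use ss X in \<open>auto simp: mult.assoc\<close>)
          then have "(\<Sum>e\<in>X. (z e * s e) *\<^sub>R u e) = 0" using rel z by simp
          then show "z e = 0" using independent_familyD[OF ind, of "\<lambda>e. z e * s e" e] e s0 by auto
        qed
      next
        assume ind: "independent_family (\<lambda>e. w (\<phi> e)) X"
        show "independent_family u X"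
          unfolding independent_family_def
        proof (intro allI impI ballI)
          fix z e assume z: "(\<Sum>e\<in>X. z e *\<^sub>R u e) = 0" and e: "e \<in> X"
          then show "z e = 0"
            using rel independent_familyD[OF ind, of "\<lambda>e. z e * s e" e] e s0 by auto
        qed
      qed
    qed
    ultimately show ?thesis by blast
  qed
qed

section \<open>From matroid isomorphisms to unimodular equivalences\<close>

lemma ex_maximal_independent_subfamily:
  assumes "finite E"
  shows "\<exists>T\<subseteq>E. independent_family u T \<and> (\<forall>e\<in>E - T. \<not> independent_family u (insert e T))"
proof -
  let ?I = "{X. X \<subseteq> E \<and> independent_family u X}"
  have "finite ?I" using assms by simp
  moreover have "?I \<noteq> {}" by (auto simp: independent_family_def)
  ultimately have "\<exists>T\<in>?I. \<forall>X\<in>?I. T \<subseteq> X \<longrightarrow> T = X" by (rule finite_has_maximal)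
  then obtain T where T: "T \<subseteq> E" "independent_family u T"
    and max: "\<forall>X\<in>?I. T \<subseteq> X \<longrightarrow> T = X" by auto
  have "\<not> independent_family u (insert e T)" if "e \<in> E - T" for e
  proof
    assume "independent_family u (insert e T)"
    then have "T = insert e T" using max[rule_format, of "insert e T"] T(1) that by auto
    then show False using that by blast
  qed
  then show ?thesis using T by blast
qed

lemma in_span_of_maximal:
  assumes "independent_family u T" "finite T" "e \<notin> T \<Longrightarrow> \<not> independent_family u (insert e T)"
  shows "\<exists>a. u e = (\<Sum>t\<in>T. a t *\<^sub>R u t)"
proof (cases "e \<in> T")
  case True
  have eq: "(\<Sum>t\<in>T. (if t \<in> {e} then 1 else 0) *\<^sub>R u t) = u e"
    by (subst sum_scaleR_zero_outside) (use assms(2) True in auto)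
  show ?thesis by (rule exI, rule eq[symmetric])
next
  case False
  then show ?thesis by (intro in_span_if_dependent_insert assms)
qed

lemma span_independent_family:
  assumes "independent_family u T" "finite T" "x \<in> span (u ` T)"
  shows "\<exists>a. x = (\<Sum>t\<in>T. a t *\<^sub>R u t)"
proof -
  obtain b where "x = (\<Sum>v\<in>u ` T. b v *\<^sub>R v)"
    using assms(2,3) by (auto simp: span_finite)
  also have "\<dots> = (\<Sum>t\<in>T. b (u t) *\<^sub>R u t)"
    using independent_family_inj_on[OF assms(1,2)] by (simp add: sum.reindex)
  finally show ?thesis by (rule exI[of _ "\<lambda>t. b (u t)"])
qed

lemma matroid_isomorphic_imp_unimodular_equivalence:
  assumes u: "oriented_edges u G" and w: "oriented_edges w H" and \<phi>: "bij_betw \<phi> G H"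
    and same: "\<And>X. X \<subseteq> G \<Longrightarrow> independent_family u X \<longleftrightarrow> independent_family (\<lambda>e. w (\<phi> e)) X"
  shows "unimodularly_equivalent (convex hull (edge_vectors u G)) (convex hull (edge_vectors w H))"
proof (cases "G = {}")
  case True
  then have "H = {}" using \<phi> by (simp add: bij_betw_def)
  then show ?thesis using True
    by (auto simp: unimodularly_equivalent_def edge_vectors_def affine_map_on_def lattice_points_def bij_betw_def)
next
  case False
  then have "H \<noteq> {}" using \<phi> by (auto simp: bij_betw_def)
  let ?w = "\<lambda>e. w (\<phi> e)"
  have inj\<phi>: "inj_on \<phi> G" and im\<phi>: "\<phi> ` G = H" using \<phi> by (auto simp: bij_betw_def)
  have "finite G" by simp
  \<comment> \<open>A maximal forest of \<open>G\<close>. Independence transfers along \<phi>, so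
    \<open>T\<close> indexes bases of both spans.\<close>
  obtain T where T: "T \<subseteq> G" "independent_family u T"
    and max: "\<forall>e\<in>G - T. \<not> independent_family u (insert e T)"
    using ex_maximal_independent_subfamily[OF \<open>finite G\<close>, of u] by blast
  have finT: "finite T" by simp
  have indw: "independent_family ?w T" using same T by blast
  have "\<exists>a. u e = (\<Sum>t\<in>T. a t *\<^sub>R u t)" if "e \<in> G" for e
    by (rule in_span_of_maximal[OF T(2) finT]) (use max that in blast)
  then obtain A' where A': "\<And>e. e \<in> G \<Longrightarrow> u e = (\<Sum>t\<in>T. A' e t *\<^sub>R u t)" by metis
  have "\<exists>b. ?w e = (\<Sum>t\<in>T. b t *\<^sub>R ?w t)" if "e \<in> G" for e
  proof (rule in_span_of_maximal[OF indw finT])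
    assume "e \<notin> T"
    then show "\<not> independent_family ?w (insert e T)"
      using max that T(1) same[of "insert e T"] by blast
  qed
  then obtain B' where B': "\<And>e. e \<in> G \<Longrightarrow> ?w e = (\<Sum>t\<in>T. B' e t *\<^sub>R ?w t)" by metis
  have inj\<phi>T: "inj_on \<phi> T" using inj\<phi> T(1) inj_on_subset by blast
  have T'H: "\<phi> ` T \<subseteq> H" using T(1) im\<phi> by blast
  have indT': "independent_family w (\<phi> ` T)" using independent_family_image[OF inj\<phi>T] indw by blast
  have "\<exists>r s. (\<forall>t. r t \<in> {-1, 1}) \<and> (\<forall>e. s e \<in> {-1, 1}) \<and>
      (\<forall>e\<in>G. (\<Sum>t\<in>T. (A' e t * r t) *\<^sub>R ?w t) = s e *\<^sub>R ?w e)"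
  proof (rule sign_equivalent_coordinates[where A = "\<lambda>t e. A' e t" and B = "\<lambda>t e. B' e t" and u = u])
    show "finite G" "T \<subseteq> G" "independent_family u T" using T by simp_all
    show "independent_family u X \<longleftrightarrow> independent_family ?w X" if "X \<subseteq> G" for X using same[OF that] .
    show "u e = (\<Sum>t\<in>T. A' e t *\<^sub>R u t)" "?w e = (\<Sum>t\<in>T. B' e t *\<^sub>R ?w t)" if "e \<in> G" for e
      using A'[OF that] B'[OF that] .
    fix t e assume te: "t \<in> T" "e \<in> G"
    have "A' e t \<in> {-1, 0, 1}" by (rule forest_coordinate_of_edge[OF u T te A'[OF te(2)]])
    \<comment> \<open>Forest coordinates in \<open>H\<close> are indexed by the image forest, so the
      bound is obtained there and pulled back along \<phi>.\<close>
    moreover have "B' e (the_inv_into T \<phi> (\<phi> t)) \<in> {-1, 0, 1}"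
      by (rule forest_coordinate_of_edge[OF w T'H indT', of "\<phi> t" "\<phi> e" "\<lambda>f. B' e (the_inv_into T \<phi> f)"])
        (use te im\<phi> B'[OF te(2)] sum_reindex_inv_into[OF inj\<phi>T, of "B' e" w] in auto)
    ultimately show "A' e t \<in> {-1, 0, 1} \<and> B' e t \<in> {-1, 0, 1}"
      using the_inv_into_f_f[OF inj\<phi>T te(1)] by simp
  qed
  then obtain r s where "\<forall>t. r t \<in> {-1, 1}" "\<forall>e. s e \<in> {-1, 1}"
    and "\<forall>e\<in>G. (\<Sum>t\<in>T. (A' e t * r t) *\<^sub>R ?w t) = s e *\<^sub>R ?w e"
    by (elim exE conjE)
  then have r: "r t \<in> {-1, 1}" and s: "s e \<in> {-1, 1}"
    and rs: "e \<in> G \<Longrightarrow> (\<Sum>t\<in>T. (A' e t * r t) *\<^sub>R ?w t) = s e *\<^sub>R ?w e" for t e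
    by blast+
  have injuT: "inj_on u T" using independent_family_inj_on[OF T(2) finT] .
  \<comment> \<open>\<open>L\<close> is prescribed with the row signs on the forest vectors alone
    and extended linearly; what matters is its restriction to the span of the edge vectors.\<close>
  obtain L where L: "linear L" and "\<forall>x\<in>u ` T. L x = r (the_inv_into T u x) *\<^sub>R ?w (the_inv_into T u x)"
    using linear_independent_extend[OF independent_family_imp_independent[OF T(2) finT],
      of "\<lambda>x. r (the_inv_into T u x) *\<^sub>R ?w (the_inv_into T u x)"] by (elim exE conjE)
  then have LT: "L (u t) = r t *\<^sub>R ?w t" if "t \<in> T" for t
    using that by (simp add: the_inv_into_f_f[OF injuT])
  have Lsum: "L (\<Sum>t\<in>T. a t *\<^sub>R u t) = (\<Sum>t\<in>T. (a t * r t) *\<^sub>R ?w t)" for a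
    unfolding linear_sum[OF L] by (rule sum.cong) (simp_all add: linear_scale[OF L] LT)
  \<comment> \<open>The sign equivalence carries the rule from the forest to all edges, so that
    \<open>L\<close> maps vertices to vertices.\<close>
  have LG: "L (u e) = s e *\<^sub>R ?w e" if "e \<in> G" for e
    using Lsum[of "A' e"] A'[OF that] rs[OF that] by simp
  let ?S = "span (u ` G)"
  have "u ` G \<subseteq> span (u ` T)"
  proof
    fix x assume "x \<in> u ` G"
    then obtain e where e: "e \<in> G" "x = u e" by blast
    have "(\<Sum>t\<in>T. A' e t *\<^sub>R u t) \<in> span (u ` T)" by (intro span_sum span_scale span_base) auto
    then show "x \<in> span (u ` T)" using A'[OF e(1)] e(2) by simp
  qed
  then have "?S \<subseteq> span (u ` T)" by (rule span_minimal) simp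
  then have rep: "\<exists>a. x = (\<Sum>t\<in>T. a t *\<^sub>R u t)" if "x \<in> ?S" for x
    using span_independent_family[OF T(2) finT] that by blast
  have injL: "inj_on L ?S"
    unfolding linear_injective_on_subspace_0[OF L subspace_span]
  proof (intro ballI impI)
    fix x assume "x \<in> ?S" "L x = 0"
    then obtain a where a: "x = (\<Sum>t\<in>T. a t *\<^sub>R u t)" "(\<Sum>t\<in>T. (a t * r t) *\<^sub>R ?w t) = 0"
      using rep Lsum by metis
    have "a t = 0" if "t \<in> T" for t
      using independent_familyD[OF indw a(2) that] r[of t] by auto
    then show "x = 0" using a(1) by simp
  qed
  have LV: "L ` edge_vectors u G = edge_vectors w H"
  proof -
    have "L ` {u e, - u e} = {?w e, - ?w e}" if "e \<in> G" for e
      using LG[OF that] s[of e] linear_neg[OF L, of "u e"] by auto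
    moreover have "edge_vectors u G = (\<Union>e\<in>G. {u e, - u e})" by (auto simp: edge_vectors_def)
    moreover have "edge_vectors w H = (\<Union>e\<in>G. {?w e, - ?w e})"
      unfolding im\<phi>[symmetric] by (auto simp: edge_vectors_def)
    ultimately show ?thesis by (simp add: image_UN)
  qed
  have imP: "L ` (convex hull (edge_vectors u G)) = convex hull (edge_vectors w H)"
    using convex_hull_linear_image[OF L] LV by metis
  have affP: "affine hull (convex hull (edge_vectors u G)) = ?S"
    and affQ: "affine hull (convex hull (edge_vectors w H)) = span (w ` H)"
    using affine_hull_edge_vectors False \<open>H \<noteq> {}\<close> by auto
  have imS: "L ` ?S = span (w ` H)"
    using affine_hull_linear_image[of L "convex hull (edge_vectors u G)"] L affP affQ imP
    by (simp add: linear_conv_bounded_linear)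
  \<comment> \<open>Over a forest a vector is integral exactly when its coefficients are, and
    \<open>L\<close> changes these by signs only.\<close>
  have int: "(\<forall>k. L x $ k \<in> \<int>) \<longleftrightarrow> (\<forall>k. x $ k \<in> \<int>)" if xS: "x \<in> ?S" for x
  proof -
    obtain a where a: "x = (\<Sum>t\<in>T. a t *\<^sub>R u t)" using rep[OF xS] by blast
    define b where "b = (\<lambda>f. a (the_inv_into T \<phi> f) * r (the_inv_into T \<phi> f))"
    have b: "L x = (\<Sum>f\<in>\<phi> ` T. b f *\<^sub>R w f)"
      unfolding a Lsum b_def by (rule sum_reindex_inv_into[OF inj\<phi>T])
    have "(\<forall>k. L x $ k \<in> \<int>) \<longleftrightarrow> (\<forall>f\<in>\<phi> ` T. b f \<in> \<int>)"
      unfolding b using forest_coordinate_integral[OF w T'H indT'] integral_combination[OF w T'H] by blast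
    also have "\<dots> \<longleftrightarrow> (\<forall>t\<in>T. a t \<in> \<int>)"
    proof -
      have "b (\<phi> t) \<in> \<int> \<longleftrightarrow> a t \<in> \<int>" if "t \<in> T" for t
        using r[of t] that by (auto simp: b_def the_inv_into_f_f[OF inj\<phi>T])
      then show ?thesis by simp
    qed
    also have "\<dots> \<longleftrightarrow> (\<forall>k. x $ k \<in> \<int>)"
      unfolding a using forest_coordinate_integral[OF u T] integral_combination[OF u T(1)] by blast
    finally show ?thesis .
  qed
  have "L ` lattice_points ?S = lattice_points (span (w ` H))"
    unfolding imS[symmetric] lattice_points_def using int by auto
  then have "bij_betw L (lattice_points ?S) (lattice_points (span (w ` H)))"
    using inj_on_subset[OF injL, of "lattice_points ?S"] by (auto simp: bij_betw_def lattice_points_def)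
  moreover have "affine_map_on ?S L"
    by (simp add: affine_map_on_def linear_add[OF L] linear_scale[OF L])
  moreover have "bij_betw L ?S (span (w ` H))" using injL imS by (simp add: bij_betw_def)
  ultimately show ?thesis unfolding unimodularly_equivalent_def affP affQ using imP by blast
qed

theorem theorem4p6:
  fixes G :: "'m::finite set set" and H :: "'n::finite set set"
  assumes "simple_graph G" and "simple_graph H"
  shows "unimodularly_equivalent (symmetric_edge_polytope G) (symmetric_edge_polytope H) \<longleftrightarrow>
         matroid_isomorphic (graphic_matroid G) (graphic_matroid H)"
proof -
  obtain u w where u: "oriented_edges u G" and w: "oriented_edges w H"
    using ex_oriented_edges assms by metis
  show ?thesis
    unfolding symmetric_edge_polytope_eq[OF u] symmetric_edge_polytope_eq[OF w]
      graphic_matroid_isomorphic_iff[OF u w]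
    using unimodular_equivalence_imp_matroid_isomorphic[OF u w]
      matroid_isomorphic_imp_unimodular_equivalence[OF u w] by blast
qed

end
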